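(* Let $L\ge2$, $n\ge1$ be integers. Let $Y=Y(z)$ be the normalized solution of the $L\times L$ Fuchsian system $$\frac{dY}{dz}=\sum_{i=0}^{N+1}\frac{A_i}{z-u_i}\,Y$$ described in the context, with power series part $\Phi(w)$ at $z=1/w=\infty$, and let ${\boldsymbol f}={}^{\mathrm T}(f_0,\dots,f_{L-1})$ be the first column of $\Phi(w)$. Let $\widetilde{\boldsymbol Q}^{(i)}(w)$ $(0\le i\le L-1)$ be the row vectors of normalized Hermite–Padé polynomials of $f_0,\dots,f_{L-1}$ (see the context). Then the polynomial matrix $$R(z)=z^n\begin{bmatrix}\widetilde{\boldsymbol Q}^{(0)}(z^{-1})\\ \vdots\\ \widetilde{\boldsymbol Q}^{(L-1)}(z^{-1})\end{bmatrix}$$ realizes the Schlesinger transformation $Y\mapsto\hat Y=RY$ shifting the characteristic exponents at $z=\infty$ by $(n(L-1),-n,\dots,-n)$; that is, $\hat Y$ is a normalized solution of a Fuchsian system of the same form as the original one, in which the exponents $(\varepsilon_{\infty,0},\varepsilon_{\infty,1},\dots,\varepsilon_{\infty,L-1})$ at $z=\infty$ are replaced by $(\varepsilon_{\infty,0}+n(L-1),\varepsilon_{\infty,1}-n,\dots,\varepsilon_{\infty,L-1}-n)$.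
   Context: Fuchsian system: $A_i\in\mathbb{C}^{L\times L}$ are constant matrices, and $u_0=1,u_1,\dots,u_N,u_{N+1}=0$ are pairwise distinct points of $\mathbb{C}$; $u_{N+2}=\infty$, so that the regular singularities are $S=\{u_0,\dots,u_{N+2}\}\subset\mathbb{P}^1$. The matrix $A_{N+1}$ is upper triangular and $A_{N+2}:=-\sum_{i=0}^{N+1}A_i$ is lower triangular. The eigenvalues $\{\varepsilon_{0,j}\}_{0\le j\le L-1}$ of $A_{N+1}$ (characteristic exponents at $z=0$) have no integer differences among them, and likewise for the eigenvalues $\{\varepsilon_{\infty,j}\}$ of $A_{N+2}$ (exponents at $z=\infty$). Normalized solution: $$Y=\Psi(z)\,\mathrm{diag}(z^{\varepsilon_{0,j}})_{0\le j\le L-1}\ \text{near } z=0,\qquad Y=\Phi(w)\,\mathrm{diag}(w^{\varepsilon_{\infty,j}})_{0\le j\le L-1}\,C\ \text{near } w=1/z=0,$$ where $\Psi$ is holomorphic at $z=0$ with $\Psi(0)$ upper triangular with all diagonal entries $1$, $\Phi$ is holomorphic at $w=0$ with $\Phi(0)$ lower triangular and invertible, and $C$ is an invertible constant matrix. (Thus $f_0(0)\ne0$.) A Schlesinger transformation is a left multiplication $Y\mapsto\hat Y=RY$ by a rational function matrix $R(z)$ such that the equation $d\hat Y/dz=\hat A\hat Y$ satisfied by $\hat Y$ has the same form as the original, i.e. $\hat A=\sum_{i=0}^{N+1}\hat A_i/(z-u_i)$ with constant matrices $\hat A_i$, $\hat A_{N+1}$ upper triangular and $-\sum_{i=0}^{N+1}\hat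 A_i$ lower triangular, and $\hat Y$ has local expansions $\hat Y=\hat\Psi(z)\,\mathrm{diag}(z^{\hat\varepsilon_{0,j}})_{0\le j\le L-1}$ near $z=0$ and $\hat Y=\hat\Phi(w)\,\mathrm{diag}(w^{\hat\varepsilon_{\infty,j}})_{0\le j\le L-1}\,\hat C$ near $w=1/z=0$, where $\hat\Psi$ is holomorphic at $z=0$ with $\hat\Psi(0)$ upper triangular with all diagonal entries $1$, $\hat\Phi$ is holomorphic at $w=0$ with $\hat\Phi(0)$ lower triangular and invertible, $\hat C$ is an invertible constant matrix, and $\hat\varepsilon_{0,j}$, $\hat\varepsilon_{\infty,j}$ are the new exponents (with the exponents at $z=0$ unchanged in the present case, i.e. $\hat\varepsilon_{0,j}=\varepsilon_{0,j}$). Hermite–Padé polynomials: for each $0\le i\le L-1$, $(Q^{(i)}_j)_{0\le j\le L-1}$ are polynomials in $w$ with $\deg Q^{(i)}_j\le n-1+\delta_{i,j}$ ($\delta_{i,j}$ the Kronecker delta) and $$Q_0^{(i)}f_0+\cdots+Q_i^{(i)}f_i+wQ_{i+1}^{(i)}f_{i+1}+\cdots+wQ_{L-1}^{(i)}f_{L-1}=O(w^{nL}),$$ and $\widetilde{\boldsymbol Q}^{(i)}=\left(Q_0^{(i)},\dots,Q_i^{(i)},wQ_{i+1}^{(i)},\dots,wQ_{L-1}^{(i)}\right)$. Simultaneous Padé polynomials: for each $0\le j\le L-1$, $(P^{(j)}_i)_{0\le i\le L-1}$ are polynomials in $w$ with $\deg P_i^{(j)}\le n(L-1)-1+\delta_{i,j}$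 such that: if $j=0$, $f_0P_i^{(0)}-f_iP_0^{(0)}=O(w^{nL})$ for $1\le i\le L-1$; if $1\le j\le L-1$, $f_0P_i^{(j)}-f_iP_0^{(j)}=O(w^{nL})$ for $1\le i\le j-1$ and $f_0P_i^{(j)}-f_i\,wP_0^{(j)}=O(w^{nL})$ for $j\le i\le L-1$. Standing genericity assumption and normalization: $f_0,\dots,f_{L-1}$ are generic, in the sense that for every $i$ these two problems have solutions unique up to simultaneous multiplication by constants, and the solutions can be (and are) normalized so that $Q_i^{(i)}$ is monic of degree exactly $n$ and $P^{(i)}_i$ is monic of degree exactly $n(L-1)$. *)

theory Defs
  imports
    "HOL-Complex_Analysis.Complex_Analysis"
    "HOL-Library.Landau_Symbols"
    "Jordan_Normal_Form.Char_Poly"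
begin

text \<open>
  Matrices are those of Jordan Normal Form, with rows and columns indexed by \<open>0, \<dots>, L - 1\<close>.
  The constant is written \<open>Matrix.mat\<close> because HOL-Analysis has a different \<open>mat\<close>.
\<close>

abbreviation lower_triangular :: "complex mat \<Rightarrow> bool" where
  "lower_triangular M \<equiv> upper_triangular (transpose_mat M)"


subsection \<open>Multivalued functions on the punctured sphere\<close>

text \<open>
  A solution of a Fuchsian system is a multivalued analytic function of \<open>z\<close> outside the finite
  singular set \<open>S\<close>, that is, a single-valued function on the universal covering of the complement
  of \<open>S\<close> in the plane. As \<open>S\<close> contains 0 and 1, this covering is hyperbolic, hence can be realised
  on a plane domain \<open>dom\<close> (for example the unit disc) with a holomorphic covering map
  \<open>prj\<close>; a point \<open>x\<close> of \<open>dom\<close> lies over \<open>z = prj x\<close>.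

  ``Near \<open>z = 0\<close>'' refers to one sheet, a connected component \<open>dom0\<close> of the part of the covering
  over a punctured disc about 0, and \<open>log0\<close> is a branch there of \<open>log z\<close>. Similarly \<open>domInf\<close> is a
  component of the part over a punctured disc about infinity, and \<open>logInf\<close> is a branch there
  of \<open>log w\<close>, where \<open>w = 1 / z\<close>.
\<close>

record cover =
  dom :: "complex set"
  prj :: "complex \<Rightarrow> complex"
  dom0 :: "complex set"
  log0 :: "complex \<Rightarrow> complex"
  domInf :: "complex set"
  logInf :: "complex \<Rightarrow> complex"

definition universal_cover :: "complex set \<Rightarrow> cover \<Rightarrow> bool" where
  "universal_cover S W \<longleftrightarrow>
     open (dom W) \<and> simply_connected (dom W) \<and>
     prj W holomorphic_on dom W \<and> covering_space (dom W) (prj W) (- S) \<and>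
     (\<exists>r>0. ball 0 r \<inter> S \<subseteq> {0} \<and>
        dom0 W \<in> components {x \<in> dom W. norm (prj W x) < r}) \<and>
     continuous_on (dom0 W) (log0 W) \<and> (\<forall>x\<in>dom0 W. exp (log0 W x) = prj W x) \<and>
     (\<exists>r>0. S \<subseteq> cball 0 r \<and>
        domInf W \<in> components {x \<in> dom W. norm (prj W x) > r}) \<and>
     continuous_on (domInf W) (logInf W) \<and> (\<forall>x\<in>domInf W. exp (logInf W x) = 1 / prj W x)"


subsection \<open>Fuchsian systems and normalized solutions\<close>

definition fuchsian_coeff :: "nat \<Rightarrow> nat \<Rightarrow> (nat \<Rightarrow> complex) \<Rightarrow> (nat \<Rightarrow> complex mat) \<Rightarrow> complex \<Rightarrow> complex mat" where
  "fuchsian_coeff L N u A z = Matrix.mat L L (\<lambda>(r, s). \<Sum>i\<le>N+1. A i $$ (r, s) / (z - u i))"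

definition residue_at_infinity :: "nat \<Rightarrow> nat \<Rightarrow> (nat \<Rightarrow> complex mat) \<Rightarrow> complex mat" where
  "residue_at_infinity L N A = Matrix.mat L L (\<lambda>(r, s). - (\<Sum>i\<le>N+1. A i $$ (r, s)))"

text \<open>\<open>e 0, \<dots>, e (L - 1)\<close> are the eigenvalues of \<open>M\<close>, with multiplicity, and no two of them
  differ by an integer.\<close>

definition nonresonant_eigenvalues :: "nat \<Rightarrow> complex mat \<Rightarrow> (nat \<Rightarrow> complex) \<Rightarrow> bool" where
  "nonresonant_eigenvalues L M e \<longleftrightarrow>
     char_poly M = (\<Prod>j<L. [:- e j, 1:]) \<and>
     (\<forall>i<L. \<forall>j<L. i \<noteq> j \<longrightarrow> e i - e j \<notin> \<int>)"

definition fuchsian_system ::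
  "nat \<Rightarrow> nat \<Rightarrow> (nat \<Rightarrow> complex mat) \<Rightarrow> (nat \<Rightarrow> complex) \<Rightarrow> (nat \<Rightarrow> complex) \<Rightarrow> bool" where
  "fuchsian_system L N A e0 einf \<longleftrightarrow>
     (\<forall>i\<le>N+1. A i \<in> carrier_mat L L) \<and>
     upper_triangular (A (N+1)) \<and> lower_triangular (residue_at_infinity L N A) \<and>
     nonresonant_eigenvalues L (A (N+1)) e0 \<and>
     nonresonant_eigenvalues L (residue_at_infinity L N A) einf"

text \<open>The factor \<open>deriv (prj W) x\<close> is \<open>dz / dx\<close>: the equation \<open>dY/dz = A Y\<close> is pulled back to the
  covering.\<close>

definition solves_fuchsian ::
  "cover \<Rightarrow> nat \<Rightarrow> nat \<Rightarrow> (nat \<Rightarrow> complex) \<Rightarrow> (nat \<Rightarrow> complex mat) \<Rightarrow> (complex \<Rightarrow> complex mat) \<Rightarrow> bool" where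
  "solves_fuchsian W L N u A Y \<longleftrightarrow>
     (\<forall>x\<in>dom W. Y x \<in> carrier_mat L L \<and>
        (\<forall>i<L. \<forall>j<L. ((\<lambda>y. Y y $$ (i, j)) has_field_derivative
           deriv (prj W) x * (fuchsian_coeff L N u A (prj W x) * Y x) $$ (i, j)) (at x)))"

definition holomorphic_mat_at_0 :: "nat \<Rightarrow> (complex \<Rightarrow> complex mat) \<Rightarrow> bool" where
  "holomorphic_mat_at_0 L F \<longleftrightarrow>
     (\<forall>z. F z \<in> carrier_mat L L) \<and> (\<forall>i<L. \<forall>j<L. (\<lambda>z. F z $$ (i, j)) analytic_on {0})"

definition expansion_at_0 ::
  "cover \<Rightarrow> nat \<Rightarrow> (nat \<Rightarrow> complex) \<Rightarrow> (complex \<Rightarrow> complex mat) \<Rightarrow> (complex \<Rightarrow> complex mat) \<Rightarrow> bool" where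
  "expansion_at_0 W L e0 \<Psi> Y \<longleftrightarrow>
     holomorphic_mat_at_0 L \<Psi> \<and>
     upper_triangular (\<Psi> 0) \<and> (\<forall>j<L. \<Psi> 0 $$ (j, j) = 1) \<and>
     (\<exists>\<delta>>0. \<forall>x\<in>dom0 W. norm (prj W x) < \<delta> \<longrightarrow>
        Y x = \<Psi> (prj W x) * mat_diag L (\<lambda>j. exp (e0 j * log0 W x)))"

definition expansion_at_infinity ::
  "cover \<Rightarrow> nat \<Rightarrow> (nat \<Rightarrow> complex) \<Rightarrow> (complex \<Rightarrow> complex mat) \<Rightarrow> complex mat \<Rightarrow>
   (complex \<Rightarrow> complex mat) \<Rightarrow> bool" where
  "expansion_at_infinity W L einf \<Phi> C Y \<longleftrightarrow>
     holomorphic_mat_at_0 L \<Phi> \<and>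
     lower_triangular (\<Phi> 0) \<and> invertible_mat (\<Phi> 0) \<and>
     C \<in> carrier_mat L L \<and> invertible_mat C \<and>
     (\<exists>\<delta>>0. \<forall>x\<in>domInf W. norm (1 / prj W x) < \<delta> \<longrightarrow>
        Y x = \<Phi> (1 / prj W x) * mat_diag L (\<lambda>j. exp (einf j * logInf W x)) * C)"

definition normalized_solution ::
  "cover \<Rightarrow> nat \<Rightarrow> nat \<Rightarrow> (nat \<Rightarrow> complex) \<Rightarrow> (nat \<Rightarrow> complex mat) \<Rightarrow> (nat \<Rightarrow> complex) \<Rightarrow> (nat \<Rightarrow> complex) \<Rightarrow>
   (complex \<Rightarrow> complex mat) \<Rightarrow> (complex \<Rightarrow> complex mat) \<Rightarrow> complex mat \<Rightarrow> (complex \<Rightarrow> complex mat) \<Rightarrow> bool" where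
  "normalized_solution W L N u A e0 einf \<Psi> \<Phi> C Y \<longleftrightarrow>
     fuchsian_system L N A e0 einf \<and> solves_fuchsian W L N u A Y \<and>
     expansion_at_0 W L e0 \<Psi> Y \<and> expansion_at_infinity W L einf \<Phi> C Y"

definition rational_mat :: "nat \<Rightarrow> (complex \<Rightarrow> complex mat) \<Rightarrow> bool" where
  "rational_mat L R \<longleftrightarrow>
     (\<forall>z. R z \<in> carrier_mat L L) \<and>
     (\<forall>i<L. \<forall>j<L. \<exists>a b. b \<noteq> 0 \<and> (\<forall>z. poly b z \<noteq> 0 \<longrightarrow> R z $$ (i, j) = poly a z / poly b z))"

text \<open>\<open>Y \<mapsto> R Y\<close> is a Schlesinger transformation whose new exponents are \<open>e0\<close> and \<open>einf\<close>.\<close>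

definition schlesinger_transformation ::
  "cover \<Rightarrow> nat \<Rightarrow> nat \<Rightarrow> (nat \<Rightarrow> complex) \<Rightarrow> (nat \<Rightarrow> complex) \<Rightarrow> (nat \<Rightarrow> complex) \<Rightarrow>
   (complex \<Rightarrow> complex mat) \<Rightarrow> (complex \<Rightarrow> complex mat) \<Rightarrow> bool" where
  "schlesinger_transformation W L N u e0 einf R Y \<longleftrightarrow>
     rational_mat L R \<and>
     (\<exists>A \<Psi> \<Phi> C. normalized_solution W L N u A e0 einf \<Psi> \<Phi> C (\<lambda>x. R (prj W x) * Y x))"


subsection \<open>Hermite--Pade and simultaneous Pade problems\<close>

definition hp_row :: "nat \<Rightarrow> (nat \<Rightarrow> complex poly) \<Rightarrow> nat \<Rightarrow> complex poly" where
  "hp_row i q j = (if j \<le> i then q j else [:0, 1:] * q j)"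

definition hermite_pade ::
  "nat \<Rightarrow> nat \<Rightarrow> (nat \<Rightarrow> complex \<Rightarrow> complex) \<Rightarrow> nat \<Rightarrow> (nat \<Rightarrow> complex poly) \<Rightarrow> bool" where
  "hermite_pade L n f i q \<longleftrightarrow>
     (\<forall>j<L. degree (q j) \<le> n - 1 + (if i = j then 1 else 0)) \<and>
     (\<lambda>w. \<Sum>j<L. poly (hp_row i q j) w * f j w) \<in> O[at 0](\<lambda>w. w ^ (n * L))"

definition simultaneous_pade ::
  "nat \<Rightarrow> nat \<Rightarrow> (nat \<Rightarrow> complex \<Rightarrow> complex) \<Rightarrow> nat \<Rightarrow> (nat \<Rightarrow> complex poly) \<Rightarrow> bool" where
  "simultaneous_pade L n f j p \<longleftrightarrow>
     (\<forall>i<L. degree (p i) \<le> n * (L - 1) - 1 + (if i = j then 1 else 0)) \<and>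
     (\<forall>i\<in>{1..<L}.
        (if j = 0 \<or> i < j
         then (\<lambda>w. f 0 w * poly (p i) w - f i w * poly (p 0) w) \<in> O[at 0](\<lambda>w. w ^ (n * L))
         else (\<lambda>w. f 0 w * poly (p i) w - f i w * (w * poly (p 0) w)) \<in> O[at 0](\<lambda>w. w ^ (n * L))))"

text \<open>The solution space is one-dimensional; only the entries with index below \<open>L\<close> matter.\<close>

definition unique_up_to_constants :: "nat \<Rightarrow> ((nat \<Rightarrow> complex poly) \<Rightarrow> bool) \<Rightarrow> bool" where
  "unique_up_to_constants L prob \<longleftrightarrow>
     (\<exists>q. prob q \<and> (\<exists>j<L. q j \<noteq> 0) \<and>
        (\<forall>q'. prob q' \<longrightarrow> (\<exists>c. \<forall>j<L. q' j = Polynomial.smult c (q j))))"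

definition monic_of_degree :: "nat \<Rightarrow> complex poly \<Rightarrow> bool" where
  "monic_of_degree m q \<longleftrightarrow> degree q = m \<and> lead_coeff q = 1"

definition generic_functions :: "nat \<Rightarrow> nat \<Rightarrow> (nat \<Rightarrow> complex \<Rightarrow> complex) \<Rightarrow> bool" where
  "generic_functions L n f \<longleftrightarrow>
     (\<forall>i<L.
        unique_up_to_constants L (hermite_pade L n f i) \<and>
        (\<exists>q. hermite_pade L n f i q \<and> monic_of_degree n (q i)) \<and>
        unique_up_to_constants L (simultaneous_pade L n f i) \<and>
        (\<exists>p. simultaneous_pade L n f i p \<and> monic_of_degree (n * (L - 1)) (p i)))"

definition normalized_hermite_pade ::
  "nat \<Rightarrow> nat \<Rightarrow> (nat \<Rightarrow> complex \<Rightarrow> complex) \<Rightarrow> (nat \<Rightarrow> nat \<Rightarrow> complex poly) \<Rightarrow> bool" where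
  "normalized_hermite_pade L n f Q \<longleftrightarrow>
     (\<forall>i<L. hermite_pade L n f i (Q i) \<and> monic_of_degree n (Q i i))"

definition hp_matrix :: "nat \<Rightarrow> (nat \<Rightarrow> nat \<Rightarrow> complex poly) \<Rightarrow> complex poly mat" where
  "hp_matrix L Q = Matrix.mat L L (\<lambda>(i, j). hp_row i (Q i) j)"

definition eval_mat :: "complex poly mat \<Rightarrow> complex \<Rightarrow> complex mat" where
  "eval_mat R z = map_mat (\<lambda>q. poly q z) R"

end

theory Submission
  imports Defs
begin

text \<open>
  Put \<open>w = 1 / z\<close>. By the Hermite--Pade conditions, \<open>R \<Phi> = \<Phi>' diag (w^(n (L - 1)), w^(- n), \<dots>, w^(- n))\<close>
  with \<open>\<Phi>'\<close> holomorphic at \<open>w = 0\<close>; the factors \<open>w\<close> in the rows of \<open>R\<close> make \<open>\<Phi>' 0\<close> lower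
  triangular, and monicity makes \<open>R\<close> upper unitriangular at \<open>z = 0\<close>. The diagonal factor has
  determinant 1, so \<open>det R = det \<Phi>' / det \<Phi>\<close> is a polynomial in \<open>z\<close> with a finite limit at infinity,
  hence the constant \<open>det (R 0) = 1\<close>. So \<open>R\<close> has a polynomial inverse, and the coefficient matrix
  \<open>R' R^(-1) + R A R^(-1)\<close> of the equation for \<open>R Y\<close> has simple poles at the \<open>u i\<close> plus a polynomial part.
  The expansion of \<open>R Y\<close> at infinity shows that this matrix is \<open>O(1 / z)\<close>, which kills
  the polynomial part, and it identifies the residue at infinity as \<open>\<Phi>' 0\<close> times the diagonal matrix of new
  exponents times the inverse of \<open>\<Phi>' 0\<close>.
\<close>

subsection \<open>Matrices\<close>

text \<open>The triangularity, derivative and limit arguments all work on this explicit sum rather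
  than on scalar products of rows and columns.\<close>

lemma index_mult_mat_sum:
  assumes "A \<in> carrier_mat m n" "B \<in> carrier_mat n p" "i < m" "j < p"
  shows "(A * B) $$ (i, j) = (\<Sum>k<n. A $$ (i, k) * B $$ (k, j))"
  using assms by (auto simp: scalar_prod_def atLeast0LessThan intro!: sum.cong)

declare index_mult_mat(1) [simp del] assoc_mult_mat [simp del]

lemma square_mult_carrier_mat [simp]:
  "A \<in> carrier_mat n n \<Longrightarrow> B \<in> carrier_mat n n \<Longrightarrow> A * B \<in> carrier_mat n n"
  by (rule mult_carrier_mat)

lemma upper_triangular_mult:
  assumes "A \<in> carrier_mat n n" "B \<in> carrier_mat n n" "upper_triangular A" "upper_triangular B"
  shows "upper_triangular (A * B)"
proof (intro upper_triangularI)
  fix i j assume ij: "j < i" "i < dim_row (A * B)"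
  have "A $$ (i, k) * B $$ (k, j) = 0" if "k < n" for k
    using assms ij that by (cases "k < i") (auto simp: upper_triangular_def)
  then show "(A * B) $$ (i, j) = 0"
    using assms(1,2) ij by (subst index_mult_mat_sum[of _ n n _ n]) auto
qed

text \<open>The product of the diagonal entries is \<open>det U\<close>, which divides 1; in an
  integral domain no factor can then vanish.\<close>

lemma diag_nonzero_of_triangular_inverse:
  fixes U :: "'a :: idom mat"
  assumes "U \<in> carrier_mat n n" "V \<in> carrier_mat n n" "upper_triangular U" "V * U = 1\<^sub>m n" "i < n"
  shows "U $$ (i, i) \<noteq> 0"
proof -
  have "Determinant.det V * Determinant.det U = 1"
    using assms det_mult[of V n U] by simp
  then have "prod_list (diag_mat U) \<noteq> 0"
    using det_upper_triangular[OF assms(3,1)] by (metis mult_zero_right zero_neq_one)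
  then show ?thesis
    using assms(1,5) by (auto simp: prod_list_zero_iff diag_mat_def)
qed

text \<open>Strong induction on the column \<open>j\<close>: in \<open>(V * U) $$ (i, j) = 0\<close>
  with \<open>j < i\<close>, the terms with \<open>k > j\<close> vanish since \<open>U\<close> is
  triangular and those with \<open>k < j\<close> by induction. What is left is
  \<open>V $$ (i, j) * U $$ (j, j)\<close>, whose second factor is nonzero.\<close>

lemma upper_triangular_inverse:
  fixes U :: "'a :: idom mat"
  assumes U: "U \<in> carrier_mat n n" and V: "V \<in> carrier_mat n n"
    and up: "upper_triangular U" and inv: "V * U = 1\<^sub>m n"
  shows "upper_triangular V"
proof -
  have "\<forall>i<n. j < i \<longrightarrow> V $$ (i, j) = 0" for j
  proof (induction j rule: less_induct)
    case (less j)
    show ?case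
    proof (intro allI impI)
      fix i assume i: "i < n" "j < i"
      have "0 = (V * U) $$ (i, j)" using inv i by simp
      also have "\<dots> = (\<Sum>k<n. V $$ (i, k) * U $$ (k, j))"
        using U V i by (intro index_mult_mat_sum[of _ n n _ n]) auto
      also have "\<dots> = (\<Sum>k\<in>{j}. V $$ (i, k) * U $$ (k, j))"
      proof (intro sum.mono_neutral_right ballI)
        fix k assume k: "k \<in> {..<n} - {j}"
        show "V $$ (i, k) * U $$ (k, j) = 0"
          using less.IH[of k] k i up U by (cases "k < j") (auto simp: upper_triangular_def)
      qed (use i in auto)
      finally show "V $$ (i, j) = 0"
        using diag_nonzero_of_triangular_inverse[OF U V up inv, of j] i by auto
    qed
  qed
  then show ?thesis using V by (auto simp: upper_triangular_def)
qed

lemma invertible_mat_obtain: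
  fixes M :: "complex mat"
  assumes "M \<in> carrier_mat n n" "invertible_mat M"
  obtains V where "V \<in> carrier_mat n n" "M * V = 1\<^sub>m n" "V * M = 1\<^sub>m n"
proof -
  obtain V where V: "M * V = 1\<^sub>m n" "V * M = 1\<^sub>m (dim_row V)"
    using assms by (auto simp: invertible_mat_def inverts_mat_def)
  \<comment> \<open>\<open>invertible_mat\<close> does not state the shape of the inverse; it is
    read off from the two identities.\<close>
  have "dim_col (M * V) = n" "dim_col (V * M) = dim_row V"
    using V by auto
  then have "V \<in> carrier_mat n n" using assms(1) by auto
  with V that show thesis by auto
qed

text \<open>The Leibniz formula is a polynomial in the entries, so entrywise limits pass through
  it.\<close>

lemma tendsto_det:
  fixes F :: "'b \<Rightarrow> complex mat"
  assumes "\<And>x. F x \<in> carrier_mat n n" "G \<in> carrier_mat n n"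
    and "\<And>i j. i < n \<Longrightarrow> j < n \<Longrightarrow> ((\<lambda>x. F x $$ (i, j)) \<longlongrightarrow> G $$ (i, j)) net"
  shows "((\<lambda>x. Determinant.det (F x)) \<longlongrightarrow> Determinant.det G) net"
  unfolding det_def'[OF assms(1)] det_def'[OF assms(2)]
proof (intro tendsto_sum tendsto_mult tendsto_const tendsto_prod)
  fix p i assume "p \<in> {p. p permutes {0..<n}}" "i \<in> {0..<n}"
  then have "i < n" "p i < n" using permutes_in_image[of p "{0..<n}" i] by auto
  then show "((\<lambda>x. F x $$ (i, p i)) \<longlongrightarrow> G $$ (i, p i)) net" by (rule assms(3))
qed

text \<open>Cofactors are signed determinants of minors. Together with \<open>tendsto_det\<close>
  this controls the inverse of \<open>\<Phi> w\<close> as \<open>w\<close> tends to 0.\<close>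

lemma tendsto_adj_mat:
  fixes F :: "'b \<Rightarrow> complex mat"
  assumes F: "\<And>x. F x \<in> carrier_mat n n" and G: "G \<in> carrier_mat n n"
    and lim: "\<And>i j. i < n \<Longrightarrow> j < n \<Longrightarrow> ((\<lambda>x. F x $$ (i, j)) \<longlongrightarrow> G $$ (i, j)) net"
    and ij: "i < n" "j < n"
  shows "((\<lambda>x. adj_mat (F x) $$ (i, j)) \<longlongrightarrow> adj_mat G $$ (i, j)) net"
proof -
  have dims: "dim_row (F x) = n" "dim_col (F x) = n" "dim_row G = n" "dim_col G = n" for x
    using F[of x] G by auto
  have "((\<lambda>x. Determinant.det (mat_delete (F x) j i)) \<longlongrightarrow> Determinant.det (mat_delete G j i)) net"
  proof (rule tendsto_det[where n = "n - 1"])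
    fix k l assume "k < n - 1" "l < n - 1"
    then show "((\<lambda>x. mat_delete (F x) j i $$ (k, l)) \<longlongrightarrow> mat_delete G j i $$ (k, l)) net"
      by (auto simp: mat_delete_def dims intro!: lim)
  qed (auto simp: mat_delete_def dims)
  then show ?thesis
    using ij by (auto simp: adj_mat_def cofactor_def dims intro!: tendsto_intros)
qed

lemma det_mat_diag: "Determinant.det (mat_diag n f) = (\<Prod>j<n. f j)"
proof -
  have "upper_triangular (mat_diag n f)" by (auto simp: mat_diag_def)
  then show ?thesis
    using det_upper_triangular[of "mat_diag n f" n]
    by (simp add: mat_diag_def diag_mat_def atLeast0LessThan flip: prod.distinct_set_conv_list cong: map_cong)
qed

lemma char_poly_mat_diag: "char_poly (mat_diag n f) = (\<Prod>j<n. [:- f j, 1:])"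
proof -
  have "upper_triangular (mat_diag n f)" by (auto simp: mat_diag_def)
  then show ?thesis
    using char_poly_upper_triangular[of "mat_diag n f" n]
    by (simp add: mat_diag_def diag_mat_def atLeast0LessThan flip: prod.distinct_set_conv_list cong: map_cong)
qed

lemma diag_upper_triangular_mult:
  assumes "A \<in> carrier_mat n n" "B \<in> carrier_mat n n" "upper_triangular A" "upper_triangular B" "j < n"
  shows "(A * B) $$ (j, j) = A $$ (j, j) * B $$ (j, j)"
proof -
  have "(A * B) $$ (j, j) = (\<Sum>k<n. A $$ (j, k) * B $$ (k, j))"
    using assms by (intro index_mult_mat_sum[of _ n n _ n]) auto
  also have "\<dots> = (\<Sum>k\<in>{j}. A $$ (j, k) * B $$ (k, j))"
  proof (intro sum.mono_neutral_right ballI)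
    fix k assume "k \<in> {..<n} - {j}"
    then show "A $$ (j, k) * B $$ (k, j) = 0"
      using assms by (cases "k < j") (auto simp: upper_triangular_def)
  qed (use assms in auto)
  finally show ?thesis by simp
qed

lemma invertible_mat_iff_det:
  fixes M :: "complex mat"
  assumes "M \<in> carrier_mat n n"
  shows "invertible_mat M \<longleftrightarrow> Determinant.det M \<noteq> 0"
proof
  assume "invertible_mat M"
  then obtain V where "V \<in> carrier_mat n n" "M * V = 1\<^sub>m n" using invertible_mat_obtain[OF assms] by blast
  then have "Determinant.det M * Determinant.det V = 1" using det_mult[OF assms, of V] by simp
  then show "Determinant.det M \<noteq> 0" by auto
next
  assume d: "Determinant.det M \<noteq> 0"
  define V where "V = (1 / Determinant.det M) \<cdot>\<^sub>m adj_mat M"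
  have "M * V = 1\<^sub>m n" "V * M = 1\<^sub>m n" "V \<in> carrier_mat n n"
    using d adj_mat[OF assms] mult_smult_distrib[OF assms adj_mat(1)[OF assms]]
      mult_smult_assoc_mat[OF adj_mat(1)[OF assms] assms]
    by (auto simp: V_def)
  then show "invertible_mat M"
    using assms by (auto simp: invertible_mat_def inverts_mat_def)
qed

subsection \<open>Polynomials and analytic functions\<close>

text \<open>A nonconstant polynomial tends to infinity at infinity, so a finite limit forces degree
  0.\<close>

lemma poly_tendsto_at_infinityD:
  fixes p :: "complex poly"
  assumes "(poly p \<longlongrightarrow> c) at_infinity"
  shows "p = [:c:]"
proof -
  have "degree p = 0"
    using filterlim_poly_at_infinity[of p] assms not_tendsto_and_filterlim_at_infinity
      trivial_limit_at_infinity by blast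
  then obtain a where a: "p = [:a:]" by (rule degree_eq_zeroE)
  moreover from a have "poly p = (\<lambda>z. a)" by auto
  ultimately have "((\<lambda>z::complex. a) \<longlongrightarrow> c) at_infinity" using assms by simp
  then show ?thesis 
    using a tendsto_unique[OF trivial_limit_at_infinity _ tendsto_const] by metis
qed

text \<open>Each \<open>z * (a i / (z - u i))\<close> tends to \<open>a i\<close>, so the polynomial
  \<open>z * poly p z\<close> has a finite limit and is constant. Its value at 0 is 0, which gives
  both conclusions.\<close>

lemma partial_fraction_at_infinity:
  fixes p :: "complex poly" and a u :: "nat \<Rightarrow> complex"
  assumes "((\<lambda>z. z * ((\<Sum>i\<le>N. a i / (z - u i)) + poly p z)) \<longlongrightarrow> m) at_infinity"
  shows "p = 0" and "(\<Sum>i\<le>N. a i) = m"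
proof -
  have frac: "((\<lambda>z. z * (a i / (z - u i))) \<longlongrightarrow> a i) at_infinity" for i
  proof -
    have "filterlim (\<lambda>z::complex. z - u i) at_infinity at_infinity"
      using tendsto_add_filterlim_at_infinity'[OF filterlim_ident tendsto_const[of "- u i"]] by simp
    then have "((\<lambda>z. a i + a i * u i / (z - u i)) \<longlongrightarrow> a i + 0) at_infinity"
      by (intro tendsto_add tendsto_const tendsto_divide_0[OF tendsto_const])
    moreover have "\<forall>\<^sub>F z in at_infinity. a i + a i * u i / (z - u i) = z * (a i / (z - u i))"
    proof (rule eventually_at_infinityI[of "norm (u i) + 1"])
      fix z :: complex assume "norm (u i) + 1 \<le> norm z"
      then have "z - u i \<noteq> 0" by auto
      then show "a i + a i * u i / (z - u i) = z * (a i / (z - u i))" by (simp add: field_simps)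
    qed
    ultimately show ?thesis by (simp add: tendsto_cong)
  qed
  have "((\<lambda>z. (\<Sum>i\<le>N. z * (a i / (z - u i)))) \<longlongrightarrow> (\<Sum>i\<le>N. a i)) at_infinity"
    by (intro tendsto_sum frac)
  from tendsto_diff[OF assms this]
  have "((\<lambda>z. z * poly p z) \<longlongrightarrow> m - (\<Sum>i\<le>N. a i)) at_infinity"
    by (simp add: distrib_left sum_distrib_left)
  moreover have "(\<lambda>z. z * poly p z) = poly (pCons 0 p)" by auto
  ultimately have "pCons 0 p = [:m - (\<Sum>i\<le>N. a i):]"
    using poly_tendsto_at_infinityD by metis
  then show "p = 0" and "(\<Sum>i\<le>N. a i) = m" by auto
qed

text \<open>Riemann's removable singularity theorem applied to the bounded quotient
  \<open>h w / w ^ m\<close>. This turns the Hermite-Pade order condition into a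
  factorization.\<close>

lemma analytic_bigo_power_factor:
  fixes h :: "complex \<Rightarrow> complex"
  assumes "h analytic_on {0}" and "h \<in> O[at 0](\<lambda>w. w ^ m)"
  obtains k where "k analytic_on {0}" "\<And>w. w \<noteq> 0 \<Longrightarrow> h w = w ^ m * k w"
proof -
  obtain S where S: "open S" "0 \<in> S" "h holomorphic_on S"
    using assms(1) by (auto simp: analytic_at)
  define g where "g = (\<lambda>w. h w / w ^ m)"
  have g: "g holomorphic_on S - {0}"
    unfolding g_def by (intro holomorphic_intros holomorphic_on_subset[OF S(3)]) auto
  obtain c where "\<forall>\<^sub>F w in at 0. norm (h w) \<le> c * norm (w ^ m)"
    using assms(2) by (auto elim: landau_o.bigE)
  moreover have "\<forall>\<^sub>F w in at (0::complex). w \<noteq> 0" by (simp add: eventually_at_filter)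
  ultimately have "\<forall>\<^sub>F w in at 0. norm (g w) \<le> c"
    by eventually_elim (auto simp: g_def norm_divide divide_simps)
  then obtain k where k: "k holomorphic_on S" "\<forall>w\<in>S - {0}. k w = g w"
    using holomorphic_on_extend_bounded[OF g] S by (auto simp: interior_open)
  \<comment> \<open>The extension \<open>k\<close> agrees with the quotient only on
    \<open>S\<close>; using \<open>g\<close> itself off 0 makes the factorization valid for every
    nonzero \<open>w\<close>.\<close>
  define k' where "k' = (\<lambda>w. if w = 0 then k 0 else g w)"
  have "k' holomorphic_on S"
    using k by (auto intro: holomorphic_transform simp: k'_def)
  then show thesis
    using S that[of k'] by (auto simp: analytic_at k'_def g_def)
qed

lemma analytic_on_poly: "(\<lambda>z::complex. poly p z) analytic_on S"
proof -
  have "poly p holomorphic_on UNIV"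
    unfolding holomorphic_on_open[OF open_UNIV] using poly_DERIV by blast
  then show ?thesis
    using analytic_on_open[OF open_UNIV, of "poly p"] analytic_on_subset by blast
qed

subsection \<open>The differential equation at infinity\<close>

text \<open>Although \<open>domInf W\<close> is a single sheet, it covers the whole exterior of the
  disc. The exterior is path-connected; a path in it from the image of a point of the sheet to
  \<open>z\<close> lifts to a path that stays over the exterior, hence inside the component.\<close>

lemma prj_onto_near_infinity:
  assumes cov: "covering_space (dom W) (prj W) (- S)" and S: "S \<subseteq> cball 0 r"
    and comp: "domInf W \<in> components {x \<in> dom W. norm (prj W x) > r}"
    and z: "norm z > r"
  obtains x where "x \<in> domInf W" "prj W x = z"
proof -
  let ?D = "{x \<in> dom W. norm (prj W x) > r}"
  have sub: "domInf W \<subseteq> ?D" and "domInf W \<noteq> {}"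
    using comp in_components_subset in_components_nonempty by blast+
  then obtain x0 where x0: "x0 \<in> domInf W" by auto
  have "path_connected (- cball (0::complex) r)"
    by (rule path_connected_complement_bounded_convex) auto
  then obtain g where g: "path g" "path_image g \<subseteq> - cball 0 r"
      "pathstart g = prj W x0" "pathfinish g = z"
  proof -
    have "prj W x0 \<in> - cball 0 r" "z \<in> - cball 0 r" using x0 sub z by auto
    with \<open>path_connected (- cball 0 r)\<close> that show thesis unfolding path_connected_def by blast
  qed
  have "path_image g \<subseteq> - S" using g(2) S by auto
  then obtain h where h: "path h" "path_image h \<subseteq> dom W" "pathstart h = x0"
      "\<And>t. t \<in> {0..1} \<Longrightarrow> prj W (h t) = g t"
    using covering_space_lift_path_strong[OF cov _ g(1), of x0] x0 sub g(3) by blast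
  have "path_image h \<subseteq> ?D"
  proof
    fix y assume y: "y \<in> path_image h"
    then obtain t where t: "t \<in> {0..1}" "y = h t" by (auto simp: path_image_def)
    then have "prj W y \<in> path_image g" using h(4) by (auto simp: path_image_def)
    then have "prj W y \<in> - cball 0 r" using g(2) by blast
    then show "y \<in> ?D" using h(2) y by auto
  qed
  moreover have "x0 \<in> path_image h" using h(3) pathstart_in_path_image by blast
  ultimately have "path_image h \<subseteq> domInf W"
    using components_maximal[OF comp] x0 connected_path_image[OF h(1)] by blast
  then have "pathfinish h \<in> domInf W" using pathfinish_in_path_image by blast
  moreover have "prj W (pathfinish h) = z"
    using h(4)[of 1] g(4) by (simp add: pathfinish_def)
  ultimately show thesis using that by blast
qed

text \<open>A covering map is locally injective, and an injective holomorphic map has nonzero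
  derivative. This permits cancelling dz/dx.\<close>

lemma deriv_prj_nonzero:
  assumes "open (dom W)" "prj W holomorphic_on dom W" "covering_space (dom W) (prj W) S" "x \<in> dom W"
  shows "deriv (prj W) x \<noteq> 0"
proof -
  obtain T v q where T: "x \<in> T" "openin (top_of_set (dom W)) T" "homeomorphism T v (prj W) q"
    using covering_space_local_homeomorphism[OF assms(3,4)] by metis
  then have "open T" "T \<subseteq> dom W"
    using openin_open_eq[OF assms(1)] by auto
  moreover have "inj_on (prj W) T"
    using homeomorphism_apply1[OF T(3)] by (rule inj_on_inverseI)
  ultimately show ?thesis
    using T(1) holomorphic_on_subset[OF assms(2)] by (intro holomorphic_injective_imp_regular[of _ T])
qed

text \<open>By continuity the imaginary part of \<open>l y - l x\<close> stays below
  \<open>pi\<close> near \<open>x\<close>, so the principal branch recovers the difference: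
  \<open>l\<close> coincides locally with \<open>l x + Ln (p y / p x)\<close>, which can be
  differentiated.\<close>

lemma continuous_log_has_field_derivative:
  fixes l p :: "complex \<Rightarrow> complex"
  assumes "open D" "x \<in> D" "continuous_on D l" "\<And>y. y \<in> D \<Longrightarrow> exp (l y) = p y"
    and p: "(p has_field_derivative p') (at x)"
  shows "(l has_field_derivative p' / p x) (at x)"
proof -
  have "isCont l x" using assms(1-3) continuous_on_eq_continuous_at by blast
  then have "((\<lambda>y. Im (l y - l x)) \<longlongrightarrow> Im (l x - l x)) (nhds x)"
    by (intro tendsto_intros) (simp add: isCont_def tendsto_at_iff_tendsto_nhds)
  then have "\<forall>\<^sub>F y in nhds x. \<bar>Im (l y - l x)\<bar> < pi"
    using pi_gt_zero by (auto dest!: tendstoD simp: dist_norm)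
  moreover have "\<forall>\<^sub>F y in nhds x. y \<in> D" using assms(1,2) eventually_nhds_in_open by blast
  ultimately have ev: "\<forall>\<^sub>F y in nhds x. l x + Ln (p y / p x) = l y"
  proof eventually_elim
    case (elim y)
    then have "p y / p x = exp (l y - l x)" using assms(4)[of y] assms(4)[of x] assms(2) by (simp add: exp_diff)
    moreover have "Ln (exp (l y - l x)) = l y - l x" using elim by (intro Ln_exp) auto
    ultimately show ?case by simp
  qed
  have "p x \<noteq> 0" using assms(4)[OF assms(2)] exp_not_eq_zero[of "l x"] by simp
  then have "((\<lambda>y. l x + Ln (p y / p x)) has_field_derivative p' / p x) (at x)"
    by (auto intro!: derivative_eq_intros p)
  then show ?thesis using DERIV_cong_ev[OF refl ev refl] by simp
qed

text \<open>Multiplying \<open>Y\<close> on the right by the inverse of the constant matrix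
  \<open>C\<close> keeps the equation and leaves \<open>\<Phi> w\<close> times the diagonal of
  powers of \<open>w\<close>. Differentiating this on the covering in two ways and cancelling dz/dx
  and the exponential factors leaves a relation between single-valued functions of \<open>w\<close>.
  The matrix \<open>B\<close> is arbitrary, so the result applies to the equation of
  \<open>R Y\<close> before its Fuchsian form is known.\<close>

lemma equation_at_infinity:
  assumes W: "universal_cover S W"
    and Y: "\<And>x. x \<in> dom W \<Longrightarrow> Y x \<in> carrier_mat L L"
    and B: "\<And>z. B z \<in> carrier_mat L L"
    and ode: "\<And>x i j. x \<in> dom W \<Longrightarrow> i < L \<Longrightarrow> j < L \<Longrightarrow>
      ((\<lambda>y. Y y $$ (i, j)) has_field_derivative deriv (prj W) x * (B (prj W x) * Y x) $$ (i, j)) (at x)"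
    and exp: "expansion_at_infinity W L e \<Phi> C Y"
  shows "\<forall>\<^sub>F w in at 0. \<forall>i<L. \<forall>j<L. (B (1 / w) * \<Phi> w) $$ (i, j) =
      - (w\<^sup>2 * deriv (\<lambda>w. \<Phi> w $$ (i, j)) w) - w * (\<Phi> w $$ (i, j) * e j)"
proof -
  obtain r where r: "r > 0" "S \<subseteq> cball 0 r"
      "domInf W \<in> components {x \<in> dom W. norm (prj W x) > r}"
    and dom: "open (dom W)" and hol: "prj W holomorphic_on dom W"
    and cov: "covering_space (dom W) (prj W) (- S)"
    and lcont: "continuous_on (domInf W) (logInf W)"
    and lexp: "\<And>x. x \<in> domInf W \<Longrightarrow> exp (logInf W x) = 1 / prj W x"
    using W unfolding universal_cover_def by blast
  obtain \<delta> where \<delta>: "\<delta> > 0" "\<And>x. x \<in> domInf W \<Longrightarrow> norm (1 / prj W x) < \<delta> \<Longrightarrow>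
      Y x = \<Phi> (1 / prj W x) * mat_diag L (\<lambda>j. exp (e j * logInf W x)) * C"
    and \<Phi>: "\<And>z. \<Phi> z \<in> carrier_mat L L"
    and an: "\<And>i j. i < L \<Longrightarrow> j < L \<Longrightarrow> (\<lambda>z. \<Phi> z $$ (i, j)) analytic_on {0}"
    and C: "C \<in> carrier_mat L L" "invertible_mat C"
    using exp unfolding expansion_at_infinity_def holomorphic_mat_at_0_def by blast
  obtain V where V: "V \<in> carrier_mat L L" "C * V = 1\<^sub>m L" using invertible_mat_obtain[OF C] .
  have cont: "continuous_on (dom W) (prj W)" using hol holomorphic_on_imp_continuous_on by blast
  have "open {x \<in> dom W. norm (prj W x) > r}"
  proof -
    have "{x \<in> dom W. norm (prj W x) > r} = dom W \<inter> prj W -` (- cball 0 r)" by auto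
    moreover have "open (- cball (0::complex) r)" by (simp add: open_Compl)
    ultimately show ?thesis using continuous_open_preimage[OF cont dom] by metis
  qed
  then have opI: "open (domInf W)" using open_components r(3) by blast
  have sub: "domInf W \<subseteq> {x \<in> dom W. norm (prj W x) > r}" using r(3) in_components_subset by blast
  have "\<forall>\<^sub>F w in nhds 0. \<forall>i\<in>{..<L}. \<forall>j\<in>{..<L}. (\<lambda>z. \<Phi> z $$ (i, j)) analytic_on {w}"
  proof (intro eventually_ball_finite ballI finite_lessThan)
    fix i j assume "i \<in> {..<L}" "j \<in> {..<L}"
    then obtain T where T: "open T" "0 \<in> T" "(\<lambda>z. \<Phi> z $$ (i, j)) holomorphic_on T"
      using an[of i j] by (auto simp: analytic_at)
    show "\<forall>\<^sub>F w in nhds 0. (\<lambda>z. \<Phi> z $$ (i, j)) analytic_on {w}"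
      using eventually_nhds_in_open[OF T(1,2)]
      by eventually_elim (use T in \<open>auto simp: analytic_at\<close>)
  qed
  \<comment> \<open>The bound \<open>1 / r\<close> puts the point \<open>1 / w\<close> in the region
    covered by \<open>domInf W\<close>; the bound \<open>\<delta>\<close> makes the expansion valid
    there.\<close>
  moreover have "\<forall>\<^sub>F w in nhds 0. w \<in> ball (0::complex) (min \<delta> (1 / r))"
    using \<delta>(1) r(1) by (intro eventually_nhds_in_open) auto
  ultimately have "\<forall>\<^sub>F w in nhds 0. w \<in> ball (0::complex) (min \<delta> (1 / r)) \<and>
      (\<forall>i\<in>{..<L}. \<forall>j\<in>{..<L}. (\<lambda>z. \<Phi> z $$ (i, j)) analytic_on {w})"
    by eventually_elim auto
  then show ?thesis
    unfolding eventually_at_filter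
  proof (eventually_elim, intro impI allI)
    fix w :: complex and i j
    assume w: "w \<in> ball 0 (min \<delta> (1 / r)) \<and>
      (\<forall>i\<in>{..<L}. \<forall>j\<in>{..<L}. (\<lambda>z. \<Phi> z $$ (i, j)) analytic_on {w})"
      and w0: "w \<noteq> 0" and ij: "i < L" "j < L"
    have "norm w < 1 / r" using w by auto
    then have "norm (1 / w) > r" using w0 r(1) by (auto simp: norm_divide field_simps)
    then obtain x where x: "x \<in> domInf W" "prj W x = 1 / w"
      using prj_onto_near_infinity[OF cov r(2,3)] by blast
    have xd: "x \<in> dom W" using x sub by auto
    \<comment> \<open>\<open>p\<close> is the coordinate w = 1/z on the covering, and
      \<open>p'\<close> is dw/dx = - w^2 dz/dx.\<close>
    define p where "p = (\<lambda>y. 1 / prj W y)"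
    define p' where "p' = - (w\<^sup>2 * deriv (prj W) x)"
    have px: "p x = w" using x by (simp add: p_def)
    have "(prj W has_field_derivative deriv (prj W) x) (at x)"
      using hol dom xd holomorphic_derivI by blast
    then have p: "(p has_field_derivative p') (at x)"
      unfolding p_def p'_def using x w0
      by (auto intro!: derivative_eq_intros simp: power2_eq_square)
    have l: "(logInf W has_field_derivative p' / w) (at x)"
      using continuous_log_has_field_derivative[OF opI x(1) lcont _ p] lexp unfolding px by (simp add: p_def)
    define Z where "Z = (\<lambda>y. Y y * V)"
    have "((\<lambda>y. \<Sum>k<L. Y y $$ (i, k) * V $$ (k, j)) has_field_derivative
        (\<Sum>k<L. deriv (prj W) x * (B (prj W x) * Y x) $$ (i, k) * V $$ (k, j))) (at x)"
      using ij by (auto intro!: derivative_eq_intros ode xd)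
    also have "(\<Sum>k<L. deriv (prj W) x * (B (prj W x) * Y x) $$ (i, k) * V $$ (k, j)) =
        deriv (prj W) x * (B (prj W x) * Y x * V) $$ (i, j)"
      using ij V mult_carrier_mat[OF B Y[OF xd]]
      by (subst index_mult_mat_sum[of "B (prj W x) * Y x" L L _ L]) (auto simp: sum_distrib_left mult.assoc)
    also have "B (prj W x) * Y x * V = B (1 / w) * Z x"
      using assoc_mult_mat[OF B Y[OF xd] V(1)] x by (simp add: Z_def)
    finally have d1: "((\<lambda>y. \<Sum>k<L. Y y $$ (i, k) * V $$ (k, j)) has_field_derivative
        deriv (prj W) x * (B (1 / w) * Z x) $$ (i, j)) (at x)" .
    have Z: "Z y = \<Phi> (p y) * mat_diag L (\<lambda>j. exp (e j * logInf W y))"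
      if "y \<in> domInf W" "norm (p y) < \<delta>" for y
    proof -
      have "Z y = \<Phi> (p y) * mat_diag L (\<lambda>j. exp (e j * logInf W y)) * (C * V)"
        using \<delta>(2)[of y] that C V \<Phi>[of "p y"]
          assoc_mult_mat[of "\<Phi> (p y) * mat_diag L (\<lambda>j. exp (e j * logInf W y))" L L C L V L]
        by (auto simp: Z_def p_def)
      then show ?thesis using V(2) \<Phi>[of "p y"] by (simp add: right_mult_one_mat[of _ L L])
    qed
    have Zij: "(\<Sum>k<L. Y y $$ (i, k) * V $$ (k, j)) = \<Phi> (p y) $$ (i, j) * exp (e j * logInf W y)"
      if y: "y \<in> domInf W" "norm (p y) < \<delta>" for y
    proof -
      have "y \<in> dom W" using y sub by auto
      then have "(\<Sum>k<L. Y y $$ (i, k) * V $$ (k, j)) = Z y $$ (i, j)"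
        using ij V Y[of y] by (simp add: Z_def index_mult_mat_sum[of _ L L _ L])
      then show ?thesis using Z[OF y] ij \<Phi>[of "p y"] by (simp add: mat_diag_mult_right[of _ L L])
    qed
    have "\<forall>\<^sub>F y in nhds x. norm (p y) < \<delta>"
    proof -
      have "isCont p x" using p DERIV_isCont by blast
      then have "(p \<longlongrightarrow> w) (nhds x)"
        unfolding px[symmetric] by (simp add: isCont_def tendsto_at_iff_tendsto_nhds)
      then have "\<forall>\<^sub>F y in nhds x. p y \<in> ball 0 \<delta>" using w by (intro topological_tendstoD) auto
      then show ?thesis by simp
    qed
    moreover have "\<forall>\<^sub>F y in nhds x. y \<in> domInf W" using opI x(1) eventually_nhds_in_open by blast
    ultimately have ev: "\<forall>\<^sub>F y in nhds x. (\<Sum>k<L. Y y $$ (i, k) * V $$ (k, j)) =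
        \<Phi> (p y) $$ (i, j) * exp (e j * logInf W y)"
      by eventually_elim (rule Zij)
    define E where "E = exp (e j * logInf W x)"
    have "(\<lambda>z. \<Phi> z $$ (i, j)) field_differentiable at w"
      using w ij analytic_on_imp_differentiable_at by blast
    then have "((\<lambda>z. \<Phi> z $$ (i, j)) has_field_derivative deriv (\<lambda>z. \<Phi> z $$ (i, j)) w) (at (p x))"
      unfolding px by (simp add: DERIV_deriv_iff_field_differentiable)
    from DERIV_chain2[OF this p]
    have "((\<lambda>y. \<Phi> (p y) $$ (i, j) * exp (e j * logInf W y)) has_field_derivative
        (deriv (\<lambda>z. \<Phi> z $$ (i, j)) w * p' + \<Phi> w $$ (i, j) * (e j * (p' / w))) * E) (at x)"
      by (auto intro!: derivative_eq_intros l simp: px E_def algebra_simps)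
    then have d2: "((\<lambda>y. \<Sum>k<L. Y y $$ (i, k) * V $$ (k, j)) has_field_derivative
        (deriv (\<lambda>z. \<Phi> z $$ (i, j)) w * p' + \<Phi> w $$ (i, j) * (e j * (p' / w))) * E) (at x)"
      using DERIV_cong_ev[OF refl ev refl] by simp
    have "B (1 / w) * Z x = B (1 / w) * \<Phi> w * mat_diag L (\<lambda>j. exp (e j * logInf W x))"
      using Z[OF x(1)] w px B[of "1 / w"] \<Phi>[of w]
        assoc_mult_mat[of "B (1 / w)" L L "\<Phi> w" L "mat_diag L (\<lambda>j. exp (e j * logInf W x))" L] by simp
    then have "(B (1 / w) * Z x) $$ (i, j) = (B (1 / w) * \<Phi> w) $$ (i, j) * E"
      using B[of "1 / w"] \<Phi>[of w] ij by (simp add: mat_diag_mult_right[of _ L L] E_def)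
    then have "(deriv (prj W) x * (B (1 / w) * \<Phi> w) $$ (i, j)) * E =
        (deriv (\<lambda>z. \<Phi> z $$ (i, j)) w * p' + \<Phi> w $$ (i, j) * (e j * (p' / w))) * E"
      using DERIV_unique[OF d1 d2] by simp
    also have "deriv (\<lambda>z. \<Phi> z $$ (i, j)) w * p' + \<Phi> w $$ (i, j) * (e j * (p' / w)) =
        deriv (prj W) x * (- (w\<^sup>2 * deriv (\<lambda>w. \<Phi> w $$ (i, j)) w) - w * (\<Phi> w $$ (i, j) * e j))"
      using w0 by (simp add: p'_def algebra_simps power2_eq_square)
    finally have "(deriv (prj W) x * (B (1 / w) * \<Phi> w) $$ (i, j)) * E =
        (deriv (prj W) x * (- (w\<^sup>2 * deriv (\<lambda>w. \<Phi> w $$ (i, j)) w) - w * (\<Phi> w $$ (i, j) * e j))) * E" .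
    moreover have "E \<noteq> 0" by (simp add: E_def)
    moreover have "deriv (prj W) x \<noteq> 0" by (rule deriv_prj_nonzero[OF dom hol cov xd])
    ultimately show "(B (1 / w) * \<Phi> w) $$ (i, j) =
        - (w\<^sup>2 * deriv (\<lambda>w. \<Phi> w $$ (i, j)) w) - w * (\<Phi> w $$ (i, j) * e j)"
      by simp
  qed
qed

text \<open>Divide the equation at infinity by \<open>w\<close> and multiply on the right by the
  inverse of \<open>\<Phi> w\<close>, written as adjugate over determinant so that its limit at 0 is
  available. The derivative term tends to 0, and only the conjugate of the exponent matrix
  survives.\<close>

lemma residue_from_infinity:
  fixes \<Phi> :: "complex \<Rightarrow> complex mat"
  assumes \<Phi>: "holomorphic_mat_at_0 L \<Phi>"
    and V: "V \<in> carrier_mat L L" "\<Phi> 0 * V = 1\<^sub>m L"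
    and B: "\<And>z. B z \<in> carrier_mat L L"
    and eq: "\<forall>\<^sub>F w in at 0. \<forall>i<L. \<forall>j<L. (B (1 / w) * \<Phi> w) $$ (i, j) =
      - (w\<^sup>2 * deriv (\<lambda>w. \<Phi> w $$ (i, j)) w) - w * (\<Phi> w $$ (i, j) * e j)"
    and rs: "r < L" "s < L"
  shows "((\<lambda>z. z * B z $$ (r, s)) \<longlongrightarrow> - (\<Phi> 0 * mat_diag L e * V) $$ (r, s)) at_infinity"
proof -
  have \<Phi>c: "\<Phi> z \<in> carrier_mat L L" for z using \<Phi> by (simp add: holomorphic_mat_at_0_def)
  have an: "(\<lambda>w. \<Phi> w $$ (i, j)) analytic_on {0}" if "i < L" "j < L" for i j
    using \<Phi> that by (simp add: holomorphic_mat_at_0_def)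
  have lim: "((\<lambda>w. \<Phi> w $$ (i, j)) \<longlongrightarrow> \<Phi> 0 $$ (i, j)) (at 0)" if "i < L" "j < L" for i j
    using analytic_at_imp_isCont[OF an[OF that]] by (simp add: isCont_def)
  \<comment> \<open>Row \<open>r\<close> of the right-hand side of \<open>eq\<close>, already
    divided by \<open>w\<close>.\<close>
  define G where "G = (\<lambda>w j. - (w * deriv (\<lambda>w. \<Phi> w $$ (r, j)) w) - \<Phi> w $$ (r, j) * e j)"
  define \<Delta> where "\<Delta> = (\<lambda>w. Determinant.det (\<Phi> w))"
  have "Determinant.det (\<Phi> 0) * Determinant.det V = 1"
    using det_mult[OF \<Phi>c V(1), of 0] V(2) by simp
  then have \<Delta>0: "\<Delta> 0 \<noteq> 0" by (auto simp: \<Delta>_def)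
  have \<Delta>lim: "(\<Delta> \<longlongrightarrow> \<Delta> 0) (at 0)"
    unfolding \<Delta>_def by (rule tendsto_det[OF \<Phi>c \<Phi>c lim])
  have Glim: "((\<lambda>w. G w j) \<longlongrightarrow> - (\<Phi> 0 $$ (r, j) * e j)) (at 0)" if "j < L" for j
  proof -
    have "isCont (deriv (\<lambda>w. \<Phi> w $$ (r, j))) 0"
      using an[OF rs(1) that] by (intro analytic_at_imp_isCont analytic_deriv)
    then have "((\<lambda>w. G w j) \<longlongrightarrow> - (0 * deriv (\<lambda>w. \<Phi> w $$ (r, j)) 0) - \<Phi> 0 $$ (r, j) * e j) (at 0)"
      unfolding G_def isCont_def by (intro tendsto_intros lim rs that)
    then show ?thesis by simp
  qed
  have lim_quot: "((\<lambda>w. (\<Sum>k<L. G w k * adj_mat (\<Phi> w) $$ (k, s)) / \<Delta> w) \<longlongrightarrow>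
      (\<Sum>k<L. - (\<Phi> 0 $$ (r, k) * e k) * adj_mat (\<Phi> 0) $$ (k, s)) / \<Delta> 0) (at 0)"
    using rs by (intro tendsto_divide \<Delta>lim \<Delta>0 tendsto_sum tendsto_mult Glim tendsto_adj_mat[OF \<Phi>c \<Phi>c lim]) auto
  \<comment> \<open>At \<open>w = 0\<close> the adjugate equals \<open>\<Delta> 0\<close> times
    \<open>V\<close>, so the quotient is the product with the inverse matrix.\<close>
  have val: "(\<Sum>k<L. - (\<Phi> 0 $$ (r, k) * e k) * adj_mat (\<Phi> 0) $$ (k, s)) / \<Delta> 0 =
      - (\<Phi> 0 * mat_diag L e * V) $$ (r, s)"
  proof -
    have adj: "adj_mat (\<Phi> 0) \<in> carrier_mat L L" using adj_mat(1)[OF \<Phi>c] .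
    have "adj_mat (\<Phi> 0) = adj_mat (\<Phi> 0) * (\<Phi> 0 * V)" using adj V by simp
    also have "\<dots> = adj_mat (\<Phi> 0) * \<Phi> 0 * V" using assoc_mult_mat[OF adj \<Phi>c V(1)] by simp
    also have "\<dots> = \<Delta> 0 \<cdot>\<^sub>m V" using adj_mat(3)[OF \<Phi>c[of 0]] V mult_smult_assoc_mat[OF one_carrier_mat V(1)]
      by (simp add: \<Delta>_def)
    finally have "adj_mat (\<Phi> 0) $$ (k, s) = \<Delta> 0 * V $$ (k, s)" if "k < L" for k
      using that rs V by simp
    then have "(\<Sum>k<L. - (\<Phi> 0 $$ (r, k) * e k) * adj_mat (\<Phi> 0) $$ (k, s)) / \<Delta> 0 =
        - (\<Sum>k<L. \<Phi> 0 $$ (r, k) * e k * V $$ (k, s))"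
      using \<Delta>0 by (simp add: sum_divide_distrib mult.assoc flip: sum_negf)
    then show ?thesis
      using rs V \<Phi>c[of 0] by (simp add: mat_diag_mult_right[of _ L L] index_mult_mat_sum[of _ L L _ L] mult.assoc)
  qed
  have "((\<lambda>w. 1 / w * B (1 / w) $$ (r, s)) \<longlongrightarrow> - (\<Phi> 0 * mat_diag L e * V) $$ (r, s)) (at 0)"
  proof (rule Lim_transform_eventually[OF lim_quot[unfolded val]])
    have "\<forall>\<^sub>F w in at 0. \<Delta> w \<noteq> 0" using \<Delta>lim \<Delta>0 by (rule tendsto_imp_eventually_ne)
    moreover have "\<forall>\<^sub>F w in at (0::complex). w \<noteq> 0" by (simp add: eventually_at_filter)
    ultimately show "\<forall>\<^sub>F w in at 0. (\<Sum>k<L. G w k * adj_mat (\<Phi> w) $$ (k, s)) / \<Delta> w = 1 / w * B (1 / w) $$ (r, s)"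
      using eq
    proof eventually_elim
      case (elim w)
      have adj: "adj_mat (\<Phi> w) \<in> carrier_mat L L" using adj_mat(1)[OF \<Phi>c] .
      have "(B (1 / w) * \<Phi> w * adj_mat (\<Phi> w)) $$ (r, s) =
          (\<Sum>k<L. (B (1 / w) * \<Phi> w) $$ (r, k) * adj_mat (\<Phi> w) $$ (k, s))"
        using rs adj mult_carrier_mat[OF B \<Phi>c] by (intro index_mult_mat_sum[of _ L L _ L]) auto
      also have "\<dots> = w * (\<Sum>k<L. G w k * adj_mat (\<Phi> w) $$ (k, s))"
        unfolding sum_distrib_left
      proof (intro sum.cong refl)
        fix k assume "k \<in> {..<L}"
        then have "(B (1 / w) * \<Phi> w) $$ (r, k) = w * G w k"
          using elim(3) rs by (simp add: G_def power2_eq_square right_diff_distrib)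
        then show "(B (1 / w) * \<Phi> w) $$ (r, k) * adj_mat (\<Phi> w) $$ (k, s) =
            w * (G w k * adj_mat (\<Phi> w) $$ (k, s))" by simp
      qed
      also have "B (1 / w) * \<Phi> w * adj_mat (\<Phi> w) = B (1 / w) * (\<Phi> w * adj_mat (\<Phi> w))"
        using assoc_mult_mat[OF B \<Phi>c adj] .
      also have "\<dots> = \<Delta> w \<cdot>\<^sub>m B (1 / w)"
        using adj_mat(2)[OF \<Phi>c] mult_smult_distrib[OF B one_carrier_mat] right_mult_one_mat[OF B]
        by (simp add: \<Delta>_def)
      finally have "\<Delta> w * B (1 / w) $$ (r, s) = w * (\<Sum>k<L. G w k * adj_mat (\<Phi> w) $$ (k, s))"
        using rs B[of "1 / w"] by simp
      then show ?case using elim(1,2) by (simp add: field_simps)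
    qed
  qed
  then show ?thesis
    by (subst lim_at_infinity_0) (simp add: o_def inverse_eq_divide)
qed

subsection \<open>Polynomial gauge transformations\<close>

lemma eval_mat_carrier [simp]: "R \<in> carrier_mat m n \<Longrightarrow> eval_mat R z \<in> carrier_mat m n"
  by (simp add: eval_mat_def)

lemma dim_eval_mat [simp]:
  "dim_row (eval_mat R z) = dim_row R" "dim_col (eval_mat R z) = dim_col R"
  by (simp_all add: eval_mat_def)

lemma eval_mat_index: "R \<in> carrier_mat m n \<Longrightarrow> i < m \<Longrightarrow> j < n \<Longrightarrow> eval_mat R z $$ (i, j) = poly (R $$ (i, j)) z"
  by (simp add: eval_mat_def)

lemma eval_mat_one [simp]: "eval_mat (1\<^sub>m n) z = 1\<^sub>m n"
  by (rule eq_matI) (auto simp: eval_mat_def)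

lemma eval_mat_mult:
  assumes "R \<in> carrier_mat m n" "T \<in> carrier_mat n p"
  shows "eval_mat (R * T) z = eval_mat R z * eval_mat T z"
proof (rule eq_matI)
  fix i j assume "i < dim_row (eval_mat R z * eval_mat T z)" "j < dim_col (eval_mat R z * eval_mat T z)"
  then have ij: "i < m" "j < p" using assms by (auto simp: eval_mat_def)
  then show "eval_mat (R * T) z $$ (i, j) = (eval_mat R z * eval_mat T z) $$ (i, j)"
    using assms by (simp add: eval_mat_index[of _ m p] eval_mat_index[of _ m n] eval_mat_index[of _ n p]
      index_mult_mat_sum[of _ m n _ p] poly_sum)
qed (use assms in \<open>auto simp: eval_mat_def\<close>)

lemma det_eval_mat: "Determinant.det (eval_mat R z) = poly (Determinant.det R) z"
  unfolding eval_mat_def by (rule comm_ring_hom.hom_det) (unfold_locales; simp)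

lemma fuchsian_coeff_carrier [simp]: "fuchsian_coeff L N u A z \<in> carrier_mat L L"
  by (simp add: fuchsian_coeff_def)

text \<open>The product is linear in its middle factor, so the scalars \<open>1 / (z - u i)\<close>
  can be pulled out; \<open>X\<close> and \<open>Z\<close> will be values of polynomial matrices at
  the same \<open>z\<close>.\<close>

lemma fuchsian_coeff_sandwich:
  assumes "X \<in> carrier_mat L L" "Z \<in> carrier_mat L L" "\<And>i. i \<le> N + 1 \<Longrightarrow> A i \<in> carrier_mat L L"
    and "r < L" "s < L"
  shows "(X * fuchsian_coeff L N u A z * Z) $$ (r, s) = (\<Sum>i\<le>N+1. (X * A i * Z) $$ (r, s) / (z - u i))"
proof -
  have expand: "(X * M * Z) $$ (r, s) = (\<Sum>l<L. \<Sum>k<L. X $$ (r, k) * M $$ (k, l) * Z $$ (l, s))"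
    if "M \<in> carrier_mat L L" for M
    using assms that by (simp add: index_mult_mat_sum[of _ L L _ L] sum_distrib_right)
  have "(X * fuchsian_coeff L N u A z * Z) $$ (r, s) =
      (\<Sum>l<L. \<Sum>k<L. \<Sum>i\<le>N+1. X $$ (r, k) * A i $$ (k, l) * Z $$ (l, s) / (z - u i))"
    by (simp only: expand[OF fuchsian_coeff_carrier])
      (auto simp: fuchsian_coeff_def sum_distrib_left sum_distrib_right simp del: sum.atMost_Suc intro!: sum.cong)
  also have "\<dots> = (\<Sum>l<L. \<Sum>i\<le>N+1. \<Sum>k<L. X $$ (r, k) * A i $$ (k, l) * Z $$ (l, s) / (z - u i))"
    by (intro sum.cong refl sum.swap)
  also have "\<dots> = (\<Sum>i\<le>N+1. \<Sum>l<L. \<Sum>k<L. X $$ (r, k) * A i $$ (k, l) * Z $$ (l, s) / (z - u i))"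
    by (rule sum.swap)
  also have "\<dots> = (\<Sum>i\<le>N+1. (X * A i * Z) $$ (r, s) / (z - u i))"
    using assms(3) by (intro sum.cong refl) (simp add: expand sum_divide_distrib)
  finally show ?thesis .
qed

text \<open>The coefficient matrix of the equation for \<open>R Y\<close>; \<open>T\<close> stands for the inverse of \<open>R\<close>.\<close>

definition gauge_coeff ::
  "nat \<Rightarrow> nat \<Rightarrow> (nat \<Rightarrow> complex) \<Rightarrow> (nat \<Rightarrow> complex mat) \<Rightarrow> complex poly mat \<Rightarrow> complex poly mat \<Rightarrow>
   complex \<Rightarrow> complex mat" where
  "gauge_coeff L N u A R T z = eval_mat (map_mat pderiv R) z * eval_mat T z +
     eval_mat R z * fuchsian_coeff L N u A z * eval_mat T z"

lemma gauge_coeff_carrier: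
  "R \<in> carrier_mat L L \<Longrightarrow> T \<in> carrier_mat L L \<Longrightarrow> gauge_coeff L N u A R T z \<in> carrier_mat L L"
  by (auto simp: gauge_coeff_def intro!: add_carrier_mat mult_carrier_mat[of _ L L])

text \<open>With \<open>R\<close> and \<open>T\<close> polynomial, each entry of
  \<open>R * A i * T\<close> is a polynomial; dividing it by \<open>z - u i\<close> leaves its value
  at \<open>u i\<close> as the residue. The quotients and the term \<open>R' * T\<close> make up the
  polynomial part.\<close>

lemma gauge_coeff_partial_fractions:
  assumes R: "R \<in> carrier_mat L L" and T: "T \<in> carrier_mat L L"
    and A: "\<And>i. i \<le> N + 1 \<Longrightarrow> A i \<in> carrier_mat L L" and rs: "r < L" "s < L"
  obtains p where "\<And>z. z \<notin> u ` {..N+1} \<Longrightarrow> gauge_coeff L N u A R T z $$ (r, s) =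
    (\<Sum>i\<le>N+1. (eval_mat R (u i) * A i * eval_mat T (u i)) $$ (r, s) / (z - u i)) + poly p z"
proof -
  \<comment> \<open>\<open>A i\<close> as a matrix of constant polynomials, so that the triple
    product is formed over the polynomial ring.\<close>
  define K where "K = (\<lambda>i. map_mat (\<lambda>c. [:c:]) (A i))"
  define q where "q = (\<lambda>i. (R * K i * T) $$ (r, s))"
  have K: "K i \<in> carrier_mat L L" if "i \<le> N + 1" for i using A[OF that] by (simp add: K_def)
  have evK: "eval_mat (K i) z = A i" for i z
    by (rule eq_matI) (auto simp: K_def eval_mat_def)
  have q: "poly (q i) z = (eval_mat R z * A i * eval_mat T z) $$ (r, s)" if "i \<le> N + 1" for i z
  proof -
    have "R * K i \<in> carrier_mat L L" using R K[OF that] by simp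
    then show ?thesis
      using R T K[OF that] rs eval_mat_index[OF mult_carrier_mat[of "R * K i" L L T L], of r s z]
      by (simp add: q_def eval_mat_mult[of _ L L _ L] evK)
  qed
  \<comment> \<open>The dividend vanishes at \<open>u i\<close>, so the division is exact.\<close>
  define p where "p = (\<lambda>i. (q i - [:poly (q i) (u i):]) div [:- u i, 1:])"
  have p: "poly (q i) z / (z - u i) = poly (q i) (u i) / (z - u i) + poly (p i) z" if "z \<noteq> u i" for i z
  proof -
    have "[:- u i, 1:] dvd q i - [:poly (q i) (u i):]" by (simp flip: poly_eq_0_iff_dvd)
    then have "q i - [:poly (q i) (u i):] = [:- u i, 1:] * p i"
      unfolding p_def by (rule dvd_mult_div_cancel[symmetric])
    then have "poly (q i - [:poly (q i) (u i):]) z = poly ([:- u i, 1:] * p i) z" by simp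
    then have "poly (q i) z = poly (q i) (u i) + (z - u i) * poly (p i) z" by (simp add: algebra_simps)
    then show ?thesis using that by (simp add: add_divide_distrib)
  qed
  define d where "d = (map_mat pderiv R * T) $$ (r, s)"
  have d: "poly d z = (eval_mat (map_mat pderiv R) z * eval_mat T z) $$ (r, s)" for z
    using R T rs eval_mat_index[of "map_mat pderiv R * T" L L r s z]
    by (simp add: d_def eval_mat_mult[of _ L L _ L])
  show thesis
  proof (rule that[of "d + (\<Sum>i\<le>N+1. p i)"])
    fix z assume z: "z \<notin> u ` {..N+1}"
    have "gauge_coeff L N u A R T z $$ (r, s) = poly d z +
        (eval_mat R z * fuchsian_coeff L N u A z * eval_mat T z) $$ (r, s)"
      using R T rs by (auto simp: gauge_coeff_def d)
    also have "(eval_mat R z * fuchsian_coeff L N u A z * eval_mat T z) $$ (r, s) =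
        (\<Sum>i\<le>N+1. poly (q i) z / (z - u i))"
      using R T rs A by (subst fuchsian_coeff_sandwich) (auto simp: q simp del: sum.atMost_Suc intro!: sum.cong)
    also have "\<dots> = (\<Sum>i\<le>N+1. poly (q i) (u i) / (z - u i) + poly (p i) z)"
      using z by (intro sum.cong refl p) auto
    also have "\<dots> = (\<Sum>i\<le>N+1. (eval_mat R (u i) * A i * eval_mat T (u i)) $$ (r, s) / (z - u i)) +
        (\<Sum>i\<le>N+1. poly (p i) z)"
      by (simp add: sum.distrib q del: sum.atMost_Suc)
    finally show "gauge_coeff L N u A R T z $$ (r, s) =
        (\<Sum>i\<le>N+1. (eval_mat R (u i) * A i * eval_mat T (u i)) $$ (r, s) / (z - u i)) +
        poly (d + (\<Sum>i\<le>N+1. p i)) z"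
      by (simp add: poly_sum algebra_simps del: sum.atMost_Suc)
  qed
qed

text \<open>The product rule gives \<open>R' * Y + R * F * Y\<close>, up to the factor dz/dx;
  inserting \<open>T * R = 1\<close> in front of \<open>Y\<close> exhibits \<open>R * Y\<close> as a
  right factor.\<close>

lemma gauge_coeff_solution:
  assumes R: "R \<in> carrier_mat L L" and T: "T \<in> carrier_mat L L" and inv: "T * R = 1\<^sub>m L"
    and Y: "\<And>x. x \<in> dom W \<Longrightarrow> Y x \<in> carrier_mat L L" and x: "x \<in> dom W"
    and prj: "(prj W has_field_derivative deriv (prj W) x) (at x)"
    and ode: "\<And>i j. i < L \<Longrightarrow> j < L \<Longrightarrow> ((\<lambda>y. Y y $$ (i, j)) has_field_derivative
           deriv (prj W) x * (fuchsian_coeff L N u A (prj W x) * Y x) $$ (i, j)) (at x)"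
    and ij: "i < L" "j < L" and op: "open (dom W)"
  shows "((\<lambda>y. (eval_mat R (prj W y) * Y y) $$ (i, j)) has_field_derivative
     deriv (prj W) x * (gauge_coeff L N u A R T (prj W x) * (eval_mat R (prj W x) * Y x)) $$ (i, j)) (at x)"
proof -
  define z where "z = prj W x"
  define F where "F = fuchsian_coeff L N u A z"
  define R' where "R' = eval_mat (map_mat pderiv R) z"
  note [simp] = R T Y[OF x]
  have F[simp]: "F \<in> carrier_mat L L" by (simp add: F_def)
  have R'[simp]: "R' \<in> carrier_mat L L" by (simp add: R'_def)
  have Rz[simp]: "eval_mat R z \<in> carrier_mat L L" by simp
  have Tz[simp]: "eval_mat T z \<in> carrier_mat L L" by simp
  have TR: "eval_mat T z * eval_mat R z = 1\<^sub>m L"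
    using eval_mat_mult[OF T R, of z] by (simp add: inv)
  have "((\<lambda>y. \<Sum>k<L. poly (R $$ (i, k)) (prj W y) * Y y $$ (k, j)) has_field_derivative
      (\<Sum>k<L. (poly (pderiv (R $$ (i, k))) z * deriv (prj W) x) * Y x $$ (k, j) +
         deriv (prj W) x * (F * Y x) $$ (k, j) * poly (R $$ (i, k)) z)) (at x)"
    unfolding z_def F_def
    using ij by (intro DERIV_sum DERIV_mult ode DERIV_chain2[OF poly_DERIV prj]) auto
  also have "(\<Sum>k<L. (poly (pderiv (R $$ (i, k))) z * deriv (prj W) x) * Y x $$ (k, j) +
         deriv (prj W) x * (F * Y x) $$ (k, j) * poly (R $$ (i, k)) z) =
      deriv (prj W) x * ((\<Sum>k<L. R' $$ (i, k) * Y x $$ (k, j)) +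
        (\<Sum>k<L. eval_mat R z $$ (i, k) * (F * Y x) $$ (k, j)))"
    unfolding sum_distrib_left distrib_left sum.distrib[symmetric]
    using ij R carrier_matD[OF R] by (intro sum.cong refl) (simp add: R'_def eval_mat_index[of _ L L] eval_mat_index[of "map_mat pderiv R" L L] algebra_simps)
  also have "\<dots> = deriv (prj W) x * (R' * Y x + eval_mat R z * (F * Y x)) $$ (i, j)"
  proof -
    have "(R' * Y x) $$ (i, j) = (\<Sum>k<L. R' $$ (i, k) * Y x $$ (k, j))"
      using ij R' Y[OF x] by (intro index_mult_mat_sum[of _ L L _ L])
    moreover have "(eval_mat R z * (F * Y x)) $$ (i, j) =
        (\<Sum>k<L. eval_mat R z $$ (i, k) * (F * Y x) $$ (k, j))"
      using ij Rz mult_carrier_mat[OF F Y[OF x]] by (intro index_mult_mat_sum[of _ L L _ L])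
    ultimately show ?thesis
      using ij carrier_matD[OF R] carrier_matD[OF Y[OF x]] by simp
  qed
  also have "R' * Y x + eval_mat R z * (F * Y x) =
      gauge_coeff L N u A R T z * (eval_mat R z * Y x)"
  proof -
    have cancel: "M * eval_mat T z * (eval_mat R z * Y x) = M * Y x" if M: "M \<in> carrier_mat L L" for M
    proof -
      have "M * eval_mat T z * (eval_mat R z * Y x) = M * (eval_mat T z * (eval_mat R z * Y x))"
        using M by (intro assoc_mult_mat[of _ L L _ L _ L]) auto
      also have "eval_mat T z * (eval_mat R z * Y x) = eval_mat T z * eval_mat R z * Y x"
        by (intro assoc_mult_mat[symmetric, of _ L L _ L _ L]) auto
      finally show ?thesis using TR Y[OF x] by simp
    qed
    have RF: "eval_mat R z * F \<in> carrier_mat L L" using Rz F by (rule mult_carrier_mat)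
    have "gauge_coeff L N u A R T z * (eval_mat R z * Y x) =
        R' * eval_mat T z * (eval_mat R z * Y x) + eval_mat R z * F * eval_mat T z * (eval_mat R z * Y x)"
      unfolding gauge_coeff_def F_def[symmetric] R'_def[symmetric]
      using RF by (intro add_mult_distrib_mat[of _ L L _ _ L] mult_carrier_mat[of _ L L _ L]) auto
    also have "\<dots> = R' * Y x + eval_mat R z * (F * Y x)"
      using cancel[OF R'] cancel[OF RF] assoc_mult_mat[OF Rz F Y[OF x]] by simp
    finally show ?thesis by simp
  qed
  finally have D: "((\<lambda>y. \<Sum>k<L. poly (R $$ (i, k)) (prj W y) * Y y $$ (k, j)) has_field_derivative
      deriv (prj W) x * (gauge_coeff L N u A R T z * (eval_mat R z * Y x)) $$ (i, j)) (at x)" .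
  have "(\<Sum>k<L. poly (R $$ (i, k)) (prj W y) * Y y $$ (k, j)) = (eval_mat R (prj W y) * Y y) $$ (i, j)"
    if "y \<in> dom W" for y
    using ij Y[OF that] R by (simp add: index_mult_mat_sum[of _ L L _ L] eval_mat_index[of _ L L])
  then show ?thesis
    using has_field_derivative_transform_within_open[OF D op x] by (simp add: z_def)
qed

text \<open>Determinant 1 makes the inverse of \<open>R\<close> polynomial, so no new singularities
  arise; unitriangularity at 0 preserves the expansion and exponents there; the expansion at
  infinity removes the polynomial part and determines the residue there.\<close>

lemma schlesinger_transformation_criterion:
  assumes Y: "normalized_solution W L N u A e0 einf \<Psi> \<Phi> C Y"
    and W: "universal_cover (u ` {..N+1}) W" and u: "u (N + 1) = 0"
    and R: "R \<in> carrier_mat L L" and det: "Determinant.det R = 1"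
    and up: "upper_triangular (eval_mat R 0)" and diag: "\<And>j. j < L \<Longrightarrow> eval_mat R 0 $$ (j, j) = 1"
    and inf: "expansion_at_infinity W L e \<Phi>' C' (\<lambda>x. eval_mat R (prj W x) * Y x)"
    and nonres: "\<And>i j. i < L \<Longrightarrow> j < L \<Longrightarrow> i \<noteq> j \<Longrightarrow> e i - e j \<notin> \<int>"
  shows "schlesinger_transformation W L N u e0 e (eval_mat R) Y"
proof -
  \<comment> \<open>As \<open>det R = 1\<close>, the adjugate is the inverse over the polynomial
    ring.\<close>
  define T where "T = adj_mat R"
  have "(1 :: complex poly) \<cdot>\<^sub>m 1\<^sub>m L = 1\<^sub>m L" by (rule eq_matI) auto
  then have T: "T \<in> carrier_mat L L" and RT: "R * T = 1\<^sub>m L" and TR: "T * R = 1\<^sub>m L"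
    using adj_mat[OF R] by (simp_all add: T_def det)
  have RTz: "eval_mat R z * eval_mat T z = 1\<^sub>m L" and TRz: "eval_mat T z * eval_mat R z = 1\<^sub>m L" for z
    using eval_mat_mult[OF R T, of z] eval_mat_mult[OF T R, of z] by (simp_all add: RT TR)
  define A' where "A' = (\<lambda>i. eval_mat R (u i) * A i * eval_mat T (u i))"
  have A'_eq: "eval_mat R (u i) * A i * eval_mat T (u i) = A' i" for i
    by (simp add: A'_def)
  define Y' where "Y' = (\<lambda>x. eval_mat R (prj W x) * Y x)"
  have A: "A i \<in> carrier_mat L L" if "i \<le> N + 1" for i
    using Y that by (simp add: normalized_solution_def fuchsian_system_def)
  have A'c: "A' i \<in> carrier_mat L L" if "i \<le> N + 1" for i
    using mult_carrier_mat[OF mult_carrier_mat[OF eval_mat_carrier[OF R] A[OF that]] eval_mat_carrier[OF T]]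
    by (simp add: A'_def)
  have Yc: "Y x \<in> carrier_mat L L" if "x \<in> dom W" for x
    using Y that by (simp add: normalized_solution_def solves_fuchsian_def)
  have Y'c: "Y' x \<in> carrier_mat L L" if "x \<in> dom W" for x
    using mult_carrier_mat[OF eval_mat_carrier[OF R] Yc[OF that]] by (simp add: Y'_def)
  have op: "open (dom W)" and hol: "prj W holomorphic_on dom W"
    and cov: "covering_space (dom W) (prj W) (- u ` {..N+1})"
    using W by (simp_all add: universal_cover_def)
  let ?B = "gauge_coeff L N u A R T"
  have B: "?B z \<in> carrier_mat L L" for z by (rule gauge_coeff_carrier[OF R T])
  have ode: "((\<lambda>y. Y' y $$ (i, j)) has_field_derivative
      deriv (prj W) x * (?B (prj W x) * Y' x) $$ (i, j)) (at x)"
    if "x \<in> dom W" "i < L" "j < L" for x i j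
    unfolding Y'_def
  proof (rule gauge_coeff_solution[OF R T TR Yc that(1) _ _ that(2,3) op])
    show "(prj W has_field_derivative deriv (prj W) x) (at x)"
      using hol op that(1) holomorphic_derivI by blast
  qed (use Y that in \<open>auto simp: normalized_solution_def solves_fuchsian_def\<close>)
  note inf' = inf[folded Y'_def]
  note eq = equation_at_infinity[OF W Y'c B ode inf']
  have \<Phi>': "holomorphic_mat_at_0 L \<Phi>'" "lower_triangular (\<Phi>' 0)" "invertible_mat (\<Phi>' 0)"
    using inf by (simp_all add: expansion_at_infinity_def)
  then have \<Phi>'0: "\<Phi>' 0 \<in> carrier_mat L L" by (simp add: holomorphic_mat_at_0_def)
  obtain V where V: "V \<in> carrier_mat L L" "\<Phi>' 0 * V = 1\<^sub>m L" "V * \<Phi>' 0 = 1\<^sub>m L"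
    using invertible_mat_obtain[OF \<Phi>'0 \<Phi>'(3)] .
  define M where "M = \<Phi>' 0 * mat_diag L e * V"
  have M: "M \<in> carrier_mat L L"
    unfolding M_def using \<Phi>'0 V(1) by simp
  \<comment> \<open>The limit of \<open>z * ?B z\<close> at infinity is \<open>- M\<close>, which
    forces the polynomial part to vanish and fixes the sum of the residues; by the sign convention
    \<open>M\<close> is the new residue at infinity.\<close>
  have key: "(\<forall>z. z \<notin> u ` {..N+1} \<longrightarrow> ?B z $$ (r, s) = (\<Sum>i\<le>N+1. A' i $$ (r, s) / (z - u i))) \<and>
      (\<Sum>i\<le>N+1. A' i $$ (r, s)) = - M $$ (r, s)" if rs: "r < L" "s < L" for r s
  proof -
    obtain p where p: "\<And>z. z \<notin> u ` {..N+1} \<Longrightarrow>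
        ?B z $$ (r, s) = (\<Sum>i\<le>N+1. A' i $$ (r, s) / (z - u i)) + poly p z"
    proof (rule gauge_coeff_partial_fractions[where N = N and u = u and A = A, OF R T _ rs, unfolded A'_eq])
      show "A i \<in> carrier_mat L L" if "i \<le> N + 1" for i using A that .
    qed (rule that)
    have "((\<lambda>z. z * ?B z $$ (r, s)) \<longlongrightarrow> - M $$ (r, s)) at_infinity"
      unfolding M_def by (rule residue_from_infinity[OF \<Phi>'(1) V(1,2) B eq rs])
    moreover have "\<forall>\<^sub>F z in at_infinity. z * ?B z $$ (r, s) =
        z * ((\<Sum>i\<le>N+1. A' i $$ (r, s) / (z - u i)) + poly p z)"
    proof -
      have "bounded (u ` {..N+1})" by (intro finite_imp_bounded) auto
      then obtain b where b: "\<forall>z\<in>u ` {..N+1}. norm z \<le> b" unfolding bounded_iff ..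
      show ?thesis
      proof (rule eventually_at_infinityI[of "b + 1"])
        fix z :: complex assume "b + 1 \<le> norm z"
        then have "\<not> norm z \<le> b" by simp
        then have "z \<notin> u ` {..N+1}" using b by blast
        from p[OF this] show "z * ?B z $$ (r, s) = z * ((\<Sum>i\<le>N+1. A' i $$ (r, s) / (z - u i)) + poly p z)"
          by (rule arg_cong)
      qed
    qed
    ultimately have "((\<lambda>z. z * ((\<Sum>i\<le>N+1. A' i $$ (r, s) / (z - u i)) + poly p z)) \<longlongrightarrow> - M $$ (r, s)) at_infinity"
      by (rule Lim_transform_eventually)
    from partial_fraction_at_infinity[OF this] have "p = 0" "(\<Sum>i\<le>N+1. A' i $$ (r, s)) = - M $$ (r, s)" .
    with p show ?thesis by (simp del: sum.atMost_Suc)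
  qed
  have Beq: "?B z = fuchsian_coeff L N u A' z" if "z \<notin> u ` {..N+1}" for z
    using key that B[of z] by (intro eq_matI) (auto simp: fuchsian_coeff_def simp del: sum.atMost_Suc)
  have res: "residue_at_infinity L N A' = M"
    using key M by (intro eq_matI) (auto simp: residue_at_infinity_def simp del: sum.atMost_Suc)
  have solves: "solves_fuchsian W L N u A' Y'"
    unfolding solves_fuchsian_def
  proof (intro ballI conjI allI impI)
    fix x i j assume x: "x \<in> dom W" and ij: "i < L" "j < L"
    have "prj W x \<in> - u ` {..N+1}"
      unfolding covering_space_imp_surjective[OF cov, symmetric] using x by (rule imageI)
    then have "?B (prj W x) = fuchsian_coeff L N u A' (prj W x)" by (intro Beq) simp
    then show "((\<lambda>y. Y' y $$ (i, j)) has_field_derivative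
           deriv (prj W) x * (fuchsian_coeff L N u A' (prj W x) * Y' x) $$ (i, j)) (at x)"
      using ode[OF x ij] by simp
  qed (rule Y'c)
  have system: "fuchsian_system L N A' e0 e"
    unfolding fuchsian_system_def nonresonant_eigenvalues_def
  proof (intro conjI allI impI)
    have c: "eval_mat R 0 \<in> carrier_mat L L" "eval_mat T 0 \<in> carrier_mat L L" "A (N + 1) \<in> carrier_mat L L"
      using R T A by auto
    \<comment> \<open>Since \<open>u (N + 1) = 0\<close>, the matrix \<open>A' (N + 1)\<close> is
      the conjugate of \<open>A (N + 1)\<close> by \<open>eval_mat R 0\<close>, which is upper
      triangular together with its inverse. Triangularity and eigenvalues are thus
      inherited.\<close>
    have "upper_triangular (A (N + 1))"
      using Y by (simp add: normalized_solution_def fuchsian_system_def)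
    then show "upper_triangular (A' (N + 1))"
      unfolding A'_def u using c up upper_triangular_inverse[OF c(1,2) up TRz]
      by (intro upper_triangular_mult[of _ L]) simp_all
    have "similar_mat (A' (N + 1)) (A (N + 1))"
      unfolding A'_def u using c RTz TRz
      by (intro similar_matI[of _ _ "eval_mat R 0" "eval_mat T 0" L]) simp_all
    then show "char_poly (A' (N + 1)) = (\<Prod>j<L. [:- e0 j, 1:])"
      using Y by (simp add: char_poly_similar normalized_solution_def fuchsian_system_def nonresonant_eigenvalues_def)
    \<comment> \<open>Lower triangularity is stated through transposes, so \<open>M\<close> is
      transposed to a product of upper triangular factors.\<close>
    have tr: "transpose_mat M = transpose_mat V * (mat_diag L e * transpose_mat (\<Phi>' 0))"
    proof -
      have "transpose_mat (mat_diag L e) = mat_diag L e"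
        by (rule eq_matI) (auto simp: mat_diag_def)
      then show ?thesis unfolding M_def using \<Phi>'0 V(1) by (simp add: transpose_mult[of _ L L _ L])
    qed
    have "transpose_mat V * transpose_mat (\<Phi>' 0) = 1\<^sub>m L"
      unfolding transpose_mult[OF \<Phi>'0 V(1), symmetric] V(2) by (rule transpose_one)
    then have "upper_triangular (transpose_mat V)"
      using upper_triangular_inverse[of "transpose_mat (\<Phi>' 0)" L "transpose_mat V"] \<Phi>'(2) \<Phi>'0 V(1)
      by (simp only: transpose_carrier_mat)
    moreover have "upper_triangular (mat_diag L e)" by (auto simp: mat_diag_def)
    ultimately have "upper_triangular (transpose_mat M)"
      unfolding tr using \<Phi>'(2) \<Phi>'0 V(1)
      by (intro upper_triangular_mult[of _ L]) simp_all
    then show "upper_triangular (transpose_mat (residue_at_infinity L N A'))" by (simp add: res)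
    have "similar_mat M (mat_diag L e)"
      using M V \<Phi>'0 by (intro similar_matI[of _ _ "\<Phi>' 0" V L]) (auto simp: M_def)
    then show "char_poly (residue_at_infinity L N A') = (\<Prod>j<L. [:- e j, 1:])"
      by (simp add: res char_poly_similar char_poly_mat_diag)
  qed (use A'c nonres Y in \<open>auto simp: normalized_solution_def fuchsian_system_def nonresonant_eigenvalues_def\<close>)
  \<comment> \<open>\<open>R\<close> acts from the left and is polynomial, so it merges with
    \<open>\<Psi>\<close> and leaves the powers of \<open>z\<close> untouched.\<close>
  have zero: "expansion_at_0 W L e0 (\<lambda>z. eval_mat R z * \<Psi> z) Y'"
  proof -
    obtain \<delta> where \<Psi>: "holomorphic_mat_at_0 L \<Psi>" "upper_triangular (\<Psi> 0)" "\<And>j. j < L \<Longrightarrow> \<Psi> 0 $$ (j, j) = 1"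
      and \<delta>: "\<delta> > 0" "\<And>x. x \<in> dom0 W \<Longrightarrow> norm (prj W x) < \<delta> \<Longrightarrow>
        Y x = \<Psi> (prj W x) * mat_diag L (\<lambda>j. exp (e0 j * log0 W x))"
      using Y unfolding normalized_solution_def expansion_at_0_def by blast
    have \<Psi>c: "\<Psi> z \<in> carrier_mat L L" for z using \<Psi>(1) by (simp add: holomorphic_mat_at_0_def)
    have Rc: "eval_mat R z \<in> carrier_mat L L" for z using R by simp
    have "(\<lambda>z. (eval_mat R z * \<Psi> z) $$ (i, j)) analytic_on {0}" if "i < L" "j < L" for i j
    proof -
      have "(\<lambda>z. \<Sum>k<L. poly (R $$ (i, k)) z * \<Psi> z $$ (k, j)) analytic_on {0}"
        using \<Psi>(1) that by (intro analytic_intros analytic_on_poly) (auto simp: holomorphic_mat_at_0_def)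
      then show ?thesis
        using that R Rc \<Psi>c by (simp add: index_mult_mat_sum[of _ L L _ L] eval_mat_index[of _ L L])
    qed
    moreover have "Y' x = eval_mat R (prj W x) * \<Psi> (prj W x) * mat_diag L (\<lambda>j. exp (e0 j * log0 W x))"
      if "x \<in> dom0 W" "norm (prj W x) < \<delta>" for x
      using \<delta>(2)[OF that] assoc_mult_mat[OF Rc \<Psi>c mat_diag_dim] by (simp add: Y'_def)
    ultimately show ?thesis
      unfolding expansion_at_0_def holomorphic_mat_at_0_def
      using \<delta>(1) \<Psi>(2,3) up diag Rc \<Psi>c upper_triangular_mult[OF Rc \<Psi>c]
        diag_upper_triangular_mult[OF Rc \<Psi>c] mult_carrier_mat[OF Rc \<Psi>c]
      by (intro conjI allI impI exI[of _ \<delta>] ballI) simp_all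
  qed
  have "rational_mat L (eval_mat R)"
    unfolding rational_mat_def
  proof (intro conjI allI impI)
    fix i j assume "i < L" "j < L"
    then show "\<exists>a b. b \<noteq> 0 \<and> (\<forall>z. poly b z \<noteq> 0 \<longrightarrow> eval_mat R z $$ (i, j) = poly a z / poly b z)"
      using R by (intro exI[of _ "R $$ (i, j)"] exI[of _ 1]) (auto simp: eval_mat_index[of _ L L])
  qed (use R in auto)
  moreover have "normalized_solution W L N u A' e0 e (\<lambda>z. eval_mat R z * \<Psi> z) \<Phi>' C' Y'"
    using system solves zero inf' by (simp add: normalized_solution_def)
  ultimately show ?thesis
    unfolding schlesinger_transformation_def Y'_def by blast
qed

subsection \<open>Hermite--Pade polynomials\<close>

text \<open>\<open>reflect_poly\<close> reverses coefficients relative to the actual degree; the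
  monomial factor pads this to \<open>n\<close>, giving the polynomial z^n q(1/z), whose value at 0
  is the coefficient of w^n.\<close>

lemma poly_reflect_shift:
  fixes q :: "complex poly"
  assumes "degree q \<le> n"
  shows "z \<noteq> 0 \<Longrightarrow> poly (monom 1 (n - degree q) * reflect_poly q) z = z ^ n * poly q (1 / z)"
    and "poly (monom 1 (n - degree q) * reflect_poly q) 0 = coeff q n"
proof -
  show "poly (monom 1 (n - degree q) * reflect_poly q) z = z ^ n * poly q (1 / z)" if "z \<noteq> 0"
    using assms that by (simp add: poly_monom poly_reflect_poly_nz inverse_eq_divide power_add[symmetric] mult.assoc[symmetric])
  show "poly (monom 1 (n - degree q) * reflect_poly q) 0 = coeff q n"
    using assms by (cases "degree q = n") (auto simp: poly_monom coeff_eq_0)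
qed

text \<open>Degree \<open>n\<close> can occur on the diagonal, by the Kronecker delta, and to its
  right, by the factor \<open>w\<close>. The strict bound to the left of the diagonal makes
  \<open>R\<close> upper triangular at 0; \<open>n \<ge> 1\<close> makes \<open>n - 1\<close> a true
  subtraction.\<close>

lemma degree_hp_row:
  assumes "hermite_pade L n f i q" "n \<ge> 1" "i < L" "j < L"
  shows "degree (hp_row i q j) \<le> n" and "j < i \<Longrightarrow> degree (hp_row i q j) < n"
proof -
  have deg: "degree (q j) \<le> n - 1 + (if i = j then 1 else 0)"
    using assms by (simp add: hermite_pade_def)
  then show "degree (hp_row i q j) \<le> n"
    using assms(2) degree_pCons_le[of 0 "q j"] by (auto simp: hp_row_def split: if_splits)
  show "degree (hp_row i q j) < n" if "j < i"
    using deg assms(2) that by (auto simp: hp_row_def)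
qed

theorem theorem1p6:
  fixes L n N :: nat
    and u :: "nat \<Rightarrow> complex"
    and A :: "nat \<Rightarrow> complex mat"
    and e0 einf :: "nat \<Rightarrow> complex"
    and W :: cover
    and Y \<Psi> \<Phi> :: "complex \<Rightarrow> complex mat"
    and C :: "complex mat"
    and f :: "nat \<Rightarrow> complex \<Rightarrow> complex"
    and Q :: "nat \<Rightarrow> nat \<Rightarrow> complex poly"
  assumes "L \<ge> 2" and "n \<ge> 1"
    and "u 0 = 1" and "u (N + 1) = 0" and "inj_on u {..N+1}"
    and "universal_cover (u ` {..N+1}) W"
    and "normalized_solution W L N u A e0 einf \<Psi> \<Phi> C Y"
    and "f = (\<lambda>i w. \<Phi> w $$ (i, 0))"
    and "generic_functions L n f"
    and "normalized_hermite_pade L n f Q"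
  shows "\<exists>R :: complex poly mat. R \<in> carrier_mat L L \<and>
           (\<forall>z. z \<noteq> 0 \<longrightarrow> eval_mat R z = z ^ n \<cdot>\<^sub>m eval_mat (hp_matrix L Q) (1 / z)) \<and>
           schlesinger_transformation W L N u e0
             (\<lambda>j. if j = 0 then einf j + of_nat (n * (L - 1)) else einf j - of_nat n)
             (eval_mat R) Y"
proof -

  \<comment> \<open>The polynomial matrix and its value at z = 0\<close>
  define q where "q = (\<lambda>i j. hp_row i (Q i) j)"
  define R where "R = Matrix.mat L L (\<lambda>(i, j). monom 1 (n - degree (q i j)) * reflect_poly (q i j))"
  define e where "e = (\<lambda>j. if j = 0 then einf j + of_nat (n * (L - 1)) else einf j - of_nat n)"
  have hp: "hermite_pade L n f i (Q i)" and monic: "degree (Q i i) = n" "lead_coeff (Q i i) = 1"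
    if "i < L" for i
    using assms(10) that by (auto simp: normalized_hermite_pade_def monic_of_degree_def)
  have deg: "degree (q i j) \<le> n" "j < i \<Longrightarrow> degree (q i j) < n" if "i < L" "j < L" for i j
    using degree_hp_row[OF hp[OF that(1)] assms(2) that] by (auto simp: q_def)
  have R: "R \<in> carrier_mat L L" by (simp add: R_def)
  have Rij: "R $$ (i, j) = monom 1 (n - degree (q i j)) * reflect_poly (q i j)" if "i < L" "j < L" for i j
    using that by (simp add: R_def)
  have Rz: "eval_mat R z $$ (i, j) = z ^ n * poly (q i j) (1 / z)" if "i < L" "j < L" "z \<noteq> 0" for i j z
    using poly_reflect_shift(1)[OF deg(1)[OF that(1,2)] that(3)] that by (simp add: eval_mat_index[OF R] Rij)
  have R0: "eval_mat R 0 $$ (i, j) = coeff (q i j) n" if "i < L" "j < L" for i j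
    using poly_reflect_shift(2)[OF deg(1)[OF that]] that by (simp add: eval_mat_index[OF R] Rij)
  have Req: "eval_mat R z = z ^ n \<cdot>\<^sub>m eval_mat (hp_matrix L Q) (1 / z)" if "z \<noteq> 0" for z
    using R Rz that by (intro eq_matI) (auto simp: hp_matrix_def eval_mat_def q_def)
  have up: "upper_triangular (eval_mat R 0)"
  proof (rule upper_triangularI)
    fix i j assume "j < i" "i < dim_row (eval_mat R 0)"
    then have "j < i" "i < L" "j < L" using R by auto
    then show "eval_mat R 0 $$ (i, j) = 0" using deg(2)[of i j] by (simp add: R0 coeff_eq_0)
  qed
  have diag: "eval_mat R 0 $$ (j, j) = 1" if "j < L" for j
    using monic[OF that] that by (simp add: R0 q_def hp_row_def)

  \<comment> \<open>Factorization at infinity\<close>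
  have \<Phi>: "holomorphic_mat_at_0 L \<Phi>" "lower_triangular (\<Phi> 0)" "invertible_mat (\<Phi> 0)"
    and C: "C \<in> carrier_mat L L" "invertible_mat C"
    using assms(7) by (simp_all add: normalized_solution_def expansion_at_infinity_def)
  have \<Phi>c: "\<Phi> w \<in> carrier_mat L L" and \<Phi>an: "\<And>i j. i < L \<Longrightarrow> j < L \<Longrightarrow> (\<lambda>w. \<Phi> w $$ (i, j)) analytic_on {0}" for w
    using \<Phi>(1) by (simp_all add: holomorphic_mat_at_0_def)
  \<comment> \<open>\<open>h i j w / w ^ n\<close> is the entry of \<open>R \<Phi>\<close> at
    \<open>z = 1 / w\<close>; the column \<open>j = 0\<close> holds the Hermite-Pade
    remainders.\<close>
  define h where "h = (\<lambda>i j w. \<Sum>l<L. poly (q i l) w * \<Phi> w $$ (l, j))"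
  have h_an: "(\<lambda>w. h i j w) analytic_on {0}" if "j < L" for i j
    unfolding h_def using \<Phi>an that by (intro analytic_intros analytic_on_poly) auto
  have "\<forall>i\<in>{..<L}. \<exists>k. k analytic_on {0} \<and> (\<forall>w. w \<noteq> 0 \<longrightarrow> h i 0 w = w ^ (n * L) * k w)"
  proof
    fix i assume "i \<in> {..<L}"
    then have "(\<lambda>w. h i 0 w) \<in> O[at 0](\<lambda>w. w ^ (n * L))"
      using hp[of i] by (simp add: hermite_pade_def h_def q_def assms(8))
    moreover have "(\<lambda>w. h i 0 w) analytic_on {0}" using assms(1) by (intro h_an) simp
    ultimately obtain k where "k analytic_on {0}" "\<And>w. w \<noteq> 0 \<Longrightarrow> h i 0 w = w ^ (n * L) * k w"
      using analytic_bigo_power_factor[of "\<lambda>w. h i 0 w" "n * L"] by metis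
    then show "\<exists>k. k analytic_on {0} \<and> (\<forall>w. w \<noteq> 0 \<longrightarrow> h i 0 w = w ^ (n * L) * k w)" by blast
  qed
  from bchoice[OF this] obtain k where k_an: "\<And>i. i < L \<Longrightarrow> k i analytic_on {0}"
    and k: "\<And>i w. i < L \<Longrightarrow> w \<noteq> 0 \<Longrightarrow> h i 0 w = w ^ (n * L) * k i w" by auto
  \<comment> \<open>In column 0 the factor w^(nL) is divided out and, combined with w^(-n) from
    \<open>R\<close>, yields w^(n(L-1)); the other columns keep w^(-n). \<open>K\<close> records
    these powers.\<close>
  define \<Phi>' where "\<Phi>' = (\<lambda>w. Matrix.mat L L (\<lambda>(i, j). if j = 0 then k i w else h i j w))"
  define K where "K = (\<lambda>w (j::nat). if j = 0 then w ^ (n * (L - 1)) else 1 / w ^ n :: complex)"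
  have \<Phi>'c: "\<Phi>' w \<in> carrier_mat L L" for w by (simp add: \<Phi>'_def)
  have \<Phi>'an: "(\<lambda>w. \<Phi>' w $$ (i, j)) analytic_on {0}" if "i < L" "j < L" for i j
    using that k_an h_an by (cases "j = 0") (simp_all add: \<Phi>'_def)
  have nL: "n * L = n * (L - 1) + n" using assms(1) by (cases L) auto
  have gauge: "eval_mat R (1 / w) * \<Phi> w = \<Phi>' w * mat_diag L (K w)" if w: "w \<noteq> 0" for w
  proof -
    have "(eval_mat R (1 / w) * \<Phi> w) $$ (i, j) = \<Phi>' w $$ (i, j) * K w j" if ij: "i < L" "j < L" for i j
    proof -
      have "(eval_mat R (1 / w) * \<Phi> w) $$ (i, j) = (\<Sum>l<L. eval_mat R (1 / w) $$ (i, l) * \<Phi> w $$ (l, j))"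
        using R \<Phi>c ij by (intro index_mult_mat_sum[of _ L L _ L]) auto
      also have "\<dots> = h i j w / w ^ n"
        unfolding h_def sum_divide_distrib using ij w by (intro sum.cong refl) (simp add: Rz power_one_over)
      also have "\<dots> = \<Phi>' w $$ (i, j) * K w j"
        using ij w k[of i w] by (simp add: \<Phi>'_def K_def nL power_add)
      finally show ?thesis .
    qed
    then show ?thesis
      using R \<Phi>c[of w] \<Phi>'c[of w] by (intro eq_matI) (auto simp: mat_diag_mult_right[of _ L L] carrier_matD)
  qed

  \<comment> \<open>The determinant\<close>
  have det\<Phi>: "Determinant.det (\<Phi> 0) \<noteq> 0" using invertible_mat_iff_det[OF \<Phi>c] \<Phi>(3) by blast
  have lim: "((\<lambda>w. Determinant.det (F w)) \<longlongrightarrow> Determinant.det (F 0)) (at 0)"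
    if "holomorphic_mat_at_0 L F" for F
  proof (rule tendsto_det[of _ L])
    fix i j assume "i < L" "j < L"
    then have "(\<lambda>w. F w $$ (i, j)) analytic_on {0}" using that by (simp add: holomorphic_mat_at_0_def)
    then show "((\<lambda>w. F w $$ (i, j)) \<longlongrightarrow> F 0 $$ (i, j)) (at 0)"
      using analytic_at_imp_isCont isCont_def by blast
  qed (use that in \<open>auto simp: holomorphic_mat_at_0_def\<close>)
  have \<Phi>'h: "holomorphic_mat_at_0 L \<Phi>'" using \<Phi>'c \<Phi>'an by (simp add: holomorphic_mat_at_0_def)
  define c where "c = Determinant.det (\<Phi>' 0) / Determinant.det (\<Phi> 0)"
  have "((\<lambda>w. Determinant.det (\<Phi>' w) / Determinant.det (\<Phi> w)) \<longlongrightarrow> c) (at 0)"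
    unfolding c_def by (intro tendsto_divide lim \<Phi>'h \<Phi>(1) det\<Phi>)
  moreover have "\<forall>\<^sub>F w in at 0. Determinant.det (\<Phi>' w) / Determinant.det (\<Phi> w) = poly (Determinant.det R) (1 / w)"
  proof -
    have "\<forall>\<^sub>F w in at 0. Determinant.det (\<Phi> w) \<noteq> 0"
      using lim[OF \<Phi>(1)] det\<Phi> by (rule tendsto_imp_eventually_ne)
    moreover have "\<forall>\<^sub>F w in at (0::complex). w \<noteq> 0" by (simp add: eventually_at_filter)
    ultimately show ?thesis
    proof eventually_elim
      case (elim w)
      obtain m where m: "L = Suc m" using assms(1) by (cases L) auto
      have "Determinant.det (mat_diag L (K w)) = w ^ (n * m) * (1 / w ^ n) ^ m"
        unfolding det_mat_diag m prod.lessThan_Suc_shift by (simp add: K_def m)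
      also have "\<dots> = 1" using elim(2) by (simp add: power_one_over power_mult[symmetric] power_divide)
      finally have "Determinant.det (eval_mat R (1 / w) * \<Phi> w) = Determinant.det (\<Phi>' w)"
        using det_mult[OF \<Phi>'c, of "mat_diag L (K w)" w] by (simp add: gauge[OF elim(2)])
      then show ?case
        using det_mult[OF eval_mat_carrier[OF R] \<Phi>c, of "1 / w" w] elim(1) by (simp add: det_eval_mat field_simps)
    qed
  qed
  ultimately have "((\<lambda>w. poly (Determinant.det R) (1 / w)) \<longlongrightarrow> c) (at 0)"
    by (rule Lim_transform_eventually)
  then have "(poly (Determinant.det R) \<longlongrightarrow> c) at_infinity"
    by (subst lim_at_infinity_0) (simp add: o_def inverse_eq_divide)
  then have detc: "Determinant.det R = [:c:]" by (rule poly_tendsto_at_infinityD)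
  have "Determinant.det (eval_mat R 0) = 1"
    using det_upper_triangular[OF up eval_mat_carrier[OF R]] R diag
    by (simp add: diag_mat_def atLeast0LessThan flip: prod.distinct_set_conv_list)
  then have c1: "c = 1" by (simp add: det_eval_mat detc)
  have det: "Determinant.det R = 1" by (simp add: detc c1)
  \<comment> \<open>The constant \<open>c\<close>, known to be 1 from the value of
    \<open>det R\<close> at z = 0, has this determinant as numerator.\<close>
  have "Determinant.det (\<Phi>' 0) \<noteq> 0" using c1 by (auto simp: c_def)
  then have inv: "invertible_mat (\<Phi>' 0)" using invertible_mat_iff_det[OF \<Phi>'c] by blast
  have low: "lower_triangular (\<Phi>' 0)"
  proof (rule upper_triangularI)
    fix j i assume "i < j" "j < dim_row (transpose_mat (\<Phi>' 0))"
    then have ij: "i < j" "j < L" "i < L" by (auto simp: \<Phi>'_def)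
    \<comment> \<open>For \<open>l \<le> i < j\<close> the entry of the lower triangular
      \<open>\<Phi> 0\<close> vanishes; for \<open>l > i\<close> the extra factor \<open>w\<close>
      in \<open>hp_row\<close> does. As \<open>i < j\<close>, the column \<open>j\<close> is not the
      exceptional column 0.\<close>
    have "poly (q i l) 0 * \<Phi> 0 $$ (l, j) = 0" if "l < L" for l
    proof (cases "l \<le> i")
      case True
      then show ?thesis
        using ij \<Phi>(2) \<Phi>c[of 0] by (auto simp: upper_triangular_def)
    next
      case False
      then show ?thesis by (simp add: q_def hp_row_def)
    qed
    then have "h i j 0 = 0" unfolding h_def by (intro sum.neutral) auto
    then show "transpose_mat (\<Phi>' 0) $$ (j, i) = 0"
      using ij by (simp add: \<Phi>'_def)
  qed

  \<comment> \<open>The new exponents and their nonresonance\<close>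
  have "expansion_at_infinity W L e \<Phi>' C (\<lambda>x. eval_mat R (prj W x) * Y x)"
  proof -
    obtain \<delta> where \<delta>: "\<delta> > 0" "\<And>x. x \<in> domInf W \<Longrightarrow> norm (1 / prj W x) < \<delta> \<Longrightarrow>
        Y x = \<Phi> (1 / prj W x) * mat_diag L (\<lambda>j. exp (einf j * logInf W x)) * C"
      using assms(7) unfolding normalized_solution_def expansion_at_infinity_def by blast
    have "eval_mat R (prj W x) * Y x =
        \<Phi>' (1 / prj W x) * mat_diag L (\<lambda>j. exp (e j * logInf W x)) * C"
      if x: "x \<in> domInf W" "norm (1 / prj W x) < \<delta>" for x
    proof -
      define w where "w = 1 / prj W x"
      define D where "D = mat_diag L (\<lambda>j. exp (einf j * logInf W x))"
      have D: "D \<in> carrier_mat L L" by (simp add: D_def)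
      have w: "exp (logInf W x) = w"
        using assms(6) x(1) unfolding universal_cover_def w_def by blast
      then have w0: "w \<noteq> 0" using exp_not_eq_zero by metis
      have pw: "prj W x = 1 / w" by (simp add: w_def)
      have Rw: "eval_mat R (1 / w) \<in> carrier_mat L L" using R by simp
      have "eval_mat R (prj W x) * Y x = eval_mat R (1 / w) * (\<Phi> w * D * C)"
        using \<delta>(2)[OF x] by (simp add: pw D_def)
      also have "\<dots> = eval_mat R (1 / w) * (\<Phi> w * D) * C"
        using assoc_mult_mat[OF Rw mult_carrier_mat[OF \<Phi>c D] C(1)] by simp
      also have "eval_mat R (1 / w) * (\<Phi> w * D) = \<Phi>' w * mat_diag L (K w) * D"
        using assoc_mult_mat[OF Rw \<Phi>c[of w] D] gauge[OF w0] by simp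
      also have "\<dots> = \<Phi>' w * (mat_diag L (K w) * D)"
        using assoc_mult_mat[OF \<Phi>'c mat_diag_dim D] .
      also have "mat_diag L (K w) * D = mat_diag L (\<lambda>j. exp (e j * logInf W x))"
      proof -
        \<comment> \<open>Integer powers of \<open>w\<close> are exponentials of integer multiples
          of the given branch \<open>logInf\<close>, so they only shift the exponents.\<close>
        have "K w j * exp (einf j * logInf W x) = exp (e j * logInf W x)" for j
          by (simp add: K_def e_def distrib_right left_diff_distrib exp_add exp_diff exp_of_nat_mult w
            del: of_nat_mult)
        then show ?thesis by (simp add: D_def)
      qed
      finally show ?thesis by (simp add: w_def)
    qed
    then show ?thesis
      unfolding expansion_at_infinity_def using \<Phi>'h low inv C \<delta>(1) by blast
  qed
  moreover have "e i - e j \<notin> \<int>" if "i < L" "j < L" "i \<noteq> j" for i j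
  proof
    \<comment> \<open>The shifts are integers, so an integer difference of new exponents would give
      one of the old exponents.\<close>
    define s where "s = (\<lambda>j::nat. if j = 0 then of_nat (n * (L - 1)) else - of_nat n :: complex)"
    assume "e i - e j \<in> \<int>"
    moreover have "s l \<in> \<int>" for l by (simp add: s_def del: of_nat_mult)
    ultimately have "e i - e j - (s i - s j) \<in> \<int>" by (blast intro: Ints_diff)
    moreover have "e l = einf l + s l" for l by (simp add: e_def s_def)
    ultimately have "einf i - einf j \<in> \<int>" by (simp add: algebra_simps)
    then show False
      using assms(7) that by (auto simp: normalized_solution_def fuchsian_system_def nonresonant_eigenvalues_def)
  qed
  ultimately have "schlesinger_transformation W L N u e0 e (eval_mat R) Y"
    using schlesinger_transformation_criterion[OF assms(7,6,4) R det up diag] by blast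
  then show ?thesis using R Req unfolding e_def by blast
qed

end
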